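(* Let $(V,E,\geq)$ be a properly ordered Bratteli diagram of rank $K$, i.e. $|V_n|=K$ for all $n\ge 1$, with infinite path space $X=X_{(V,E)}$, and let $T=T_{(V,E)}$ be the associated Bratteli-Vershik map. Let $i\ge 1$. If there exist at least $$L=(K-1)2^K+2$$ distinct points $y_1,\dots,y_L\in X$ that are pairwise $i$-compatible and for some $j>i$ pairwise have no common $j$-cut (and hence are pairwise $j$-separated), then $(X_i,S_i)$ is periodic.
   Context: **Bratteli diagrams.** A Bratteli diagram $(V,E)$ consists of a vertex set $V=\bigsqcup_{n\ge 0}V_n$ and an edge set $E=\bigsqcup_{n\ge 1}E_n$, where the $V_n$ and $E_n$ are finite disjoint nonempty sets and $V_0=\{v_0\}$ is a single point, together with source and range maps $s:E_n\to V_{n-1}$, $r:E_n\to V_n$ such that $s^{-1}(v)\neq\varnothing$ for all $v\in V$ and $r^{-1}(v)\neq\varnothing$ for all $v\in V\setminus V_0$. Multiple edges are allowed. For $k<l$, $E_{k+1}\circ\cdots\circ E_l$ denotes the set of paths $(e_{k+1},\dots,e_l)$ with $e_i\in E_i$ and $r(e_i)=s(e_{i+1})$. Given $0=m_0<m_1<m_2<\cdots$, the telescoping of $(V,E)$ to $\{m_n\}$ is the Bratteli diagram with vertex sets $V'_n=V_{m_n}$ and edge sets $E'_n=E_{m_{n-1}+1}\circ\cdots\circ E_{m_n}$ (source and range of a path being the source of its first edge and the range of its last edge). The diagram is *simple* if it has a telescoping in which, for each $n\ge1$, every vertex of level $n-1$ is connected by at least one edge to every vertex of level $n$. **Path space.**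 $X_{(V,E)}=\{(e_1,e_2,\dots): e_i\in E_i,\ r(e_i)=s(e_{i+1})\ \forall i\ge 1\}$, with the relative topology from the product topology on $\prod_n E_n$ (each $E_n$ discrete). The case where $X_{(V,E)}$ is finite is disregarded. **Ordered diagrams.** An ordered Bratteli diagram $(V,E,\geq)$ is a Bratteli diagram with a partial order on $E$ such that two edges are comparable iff they have the same range; thus each $r^{-1}(v)$, $v\in V\setminus V_0$, is linearly ordered. $E_{\min}$ and $E_{\max}$ are the sets of minimal and maximal edges. It is *properly ordered* if $(V,E)$ is simple and there is a unique path $x_{\min}\in X_{(V,E)}$ all of whose edges are in $E_{\min}$ and a unique path $x_{\max}\in X_{(V,E)}$ all of whose edges are in $E_{\max}$. **Bratteli-Vershik map.** For $(V,E,\geq)$ properly ordered, $T_{(V,E)}:X_{(V,E)}\to X_{(V,E)}$ is defined by $T_{(V,E)}x_{\max}=x_{\min}$ and, for $x=(e_1,e_2,\dots)\ne x_{\max}$, by $T_{(V,E)}x=(f_1,\dots,f_k,e_{k+1},e_{k+2},\dots)$, where $k$ is the smallest index with $e_k\notin E_{\max}$, $f_k$ is the successor of $e_k$ in $r^{-1}(r(e_k))$, and $(f_1,\dots,f_{k-1})$ is the unique path from $v_0$ to $s(f_k)$ consisting of minimal edges. $T_{(V,E)}$ is a minimal homeomorphism. **Symbolic factors.** For $k\ge1$ let $P_k=E_1\circ\cdots\circ E_k$ be the finite set of paths from $v_0$ to level $k$, and $\tau_k:X\to P_k$, $\tau_k(e_1,e_2,\dots)=(e_1,\dots,e_k)$.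 Define $\pi_k:X\to P_k^{\mathbb Z}$ by $\pi_k(x)=(\tau_k(T^nx))_{n\in\mathbb Z}$, and let $X_k=\pi_k(X)$ with $S_k$ the restriction to $X_k$ of the left shift on $P_k^{\mathbb Z}$. Then $(X_k,S_k)$ is a minimal subshift and a factor of $(X,T)$ via $\pi_k$. $(X_k,S_k)$ is *periodic* if $X_k$ is a single finite (periodic) orbit of $S_k$. **Compatibility, separation, cuts.** A pair $(x,x')$ of distinct points of $X$ is *$i$-compatible* if $\pi_i(x)=\pi_i(x')$, and *$j$-separated* if $\pi_j(x)\ne\pi_j(x')$. A pair $(x,x')$ has a *common $j$-cut* if for some $m\in\mathbb Z$ both $\tau_j(T^mx)$ and $\tau_j(T^mx')$ consist only of minimal edges. *)

theory Defs
  imports Complex_Main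
begin

text \<open>Only the edge sets \<^term>\<open>edges B n\<close> with \<^term>\<open>n \<ge> (1::nat)\<close> are meaningful;
  \<^term>\<open>edges B 0\<close> is never used.\<close>

record ('v, 'e) bratteli =
  verts :: "nat \<Rightarrow> 'v set"
  edges :: "nat \<Rightarrow> 'e set"
  src :: "'e \<Rightarrow> 'v"
  rng :: "'e \<Rightarrow> 'v"

record ('v, 'e) ordered_bratteli = "('v, 'e) bratteli" +
  edge_order :: "('e \<times> 'e) set"  \<comment> \<open>\<open>(e, f)\<close> is in the relation iff \<open>e \<le> f\<close>\<close>

definition all_verts :: "('v, 'e, 'z) bratteli_scheme \<Rightarrow> 'v set" where
  "all_verts B = (\<Union>n. verts B n)"

definition all_edges :: "('v, 'e, 'z) bratteli_scheme \<Rightarrow> 'e set" where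
  "all_edges B = (\<Union>n\<in>{1..}. edges B n)"

definition bratteli_diagram :: "('v, 'e, 'z) bratteli_scheme \<Rightarrow> bool" where
  "bratteli_diagram B \<longleftrightarrow>
     (\<forall>n. finite (verts B n) \<and> verts B n \<noteq> {}) \<and>
     (\<forall>m n. m \<noteq> n \<longrightarrow> verts B m \<inter> verts B n = {}) \<and>
     (\<exists>v0. verts B 0 = {v0}) \<and>
     (\<forall>n\<ge>1. finite (edges B n) \<and> edges B n \<noteq> {}) \<and>
     (\<forall>m\<ge>1. \<forall>n\<ge>1. m \<noteq> n \<longrightarrow> edges B m \<inter> edges B n = {}) \<and>
     (\<forall>n\<ge>1. \<forall>e\<in>edges B n. src B e \<in> verts B (n - 1) \<and> rng B e \<in> verts B n) \<and>
     (\<forall>v\<in>all_verts B. \<exists>e\<in>all_edges B. src B e = v) \<and>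
     (\<forall>v\<in>all_verts B - verts B 0. \<exists>e\<in>all_edges B. rng B e = v)"

text \<open>The set \<open>E\<^bsub>k+1\<^esub> \<circ> \<dots> \<circ> E\<^bsub>l\<^esub>\<close>; the list entry with index \<open>t\<close> is the edge \<open>e\<^bsub>k+1+t\<^esub>\<close>.\<close>

definition paths :: "('v, 'e, 'z) bratteli_scheme \<Rightarrow> nat \<Rightarrow> nat \<Rightarrow> 'e list set" where
  "paths B k l = {es. length es = l - k \<and>
     (\<forall>t<length es. es ! t \<in> edges B (k + 1 + t)) \<and>
     (\<forall>t. Suc t < length es \<longrightarrow> rng B (es ! t) = src B (es ! Suc t))}"

definition telescope ::
  "('v, 'e, 'z) bratteli_scheme \<Rightarrow> (nat \<Rightarrow> nat) \<Rightarrow> ('v, 'e list) bratteli" where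
  "telescope B m =
     \<lparr>verts = (\<lambda>n. verts B (m n)),
      edges = (\<lambda>n. paths B (m (n - 1)) (m n)),
      src = (\<lambda>es. src B (hd es)),
      rng = (\<lambda>es. rng B (last es))\<rparr>"

definition fully_connected :: "('v, 'e, 'z) bratteli_scheme \<Rightarrow> bool" where
  "fully_connected B \<longleftrightarrow>
     (\<forall>n\<ge>1. \<forall>u\<in>verts B (n - 1). \<forall>v\<in>verts B n. \<exists>e\<in>edges B n. src B e = u \<and> rng B e = v)"

definition simple_diagram :: "('v, 'e, 'z) bratteli_scheme \<Rightarrow> bool" where
  "simple_diagram B \<longleftrightarrow>
     (\<exists>m. m 0 = 0 \<and> strict_mono m \<and> fully_connected (telescope B m))"

definition has_rank :: "('v, 'e, 'z) bratteli_scheme \<Rightarrow> nat \<Rightarrow> bool" where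
  "has_rank B K \<longleftrightarrow> (\<forall>n\<ge>1. card (verts B n) = K)"

text \<open>An infinite path \<open>(e\<^sub>1, e\<^sub>2, \<dots>)\<close> is represented by the function \<open>x\<close> with
  \<open>x n = e\<^bsub>n+1\<^esub>\<close>.\<close>

definition path_space :: "('v, 'e, 'z) bratteli_scheme \<Rightarrow> (nat \<Rightarrow> 'e) set" where
  "path_space B = {x. \<forall>n. x n \<in> edges B (Suc n) \<and> rng B (x n) = src B (x (Suc n))}"

definition ordered_bratteli_diagram :: "('v, 'e, 'z) ordered_bratteli_scheme \<Rightarrow> bool" where
  "ordered_bratteli_diagram B \<longleftrightarrow>
     bratteli_diagram B \<and>
     partial_order_on (all_edges B) (edge_order B) \<and>
     (\<forall>e\<in>all_edges B. \<forall>f\<in>all_edges B.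
        ((e, f) \<in> edge_order B \<or> (f, e) \<in> edge_order B) \<longleftrightarrow> rng B e = rng B f)"

definition min_edges :: "('v, 'e, 'z) ordered_bratteli_scheme \<Rightarrow> 'e set" where
  "min_edges B = {e \<in> all_edges B. \<forall>f\<in>all_edges B. (f, e) \<in> edge_order B \<longrightarrow> f = e}"

definition max_edges :: "('v, 'e, 'z) ordered_bratteli_scheme \<Rightarrow> 'e set" where
  "max_edges B = {e \<in> all_edges B. \<forall>f\<in>all_edges B. (e, f) \<in> edge_order B \<longrightarrow> f = e}"

definition properly_ordered :: "('v, 'e, 'z) ordered_bratteli_scheme \<Rightarrow> bool" where
  "properly_ordered B \<longleftrightarrow>
     ordered_bratteli_diagram B \<and> simple_diagram B \<and>
     (\<exists>!x. x \<in> path_space B \<and> (\<forall>n. x n \<in> min_edges B)) \<and>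
     (\<exists>!x. x \<in> path_space B \<and> (\<forall>n. x n \<in> max_edges B))"

definition x_min :: "('v, 'e, 'z) ordered_bratteli_scheme \<Rightarrow> nat \<Rightarrow> 'e" where
  "x_min B = (THE x. x \<in> path_space B \<and> (\<forall>n. x n \<in> min_edges B))"

definition x_max :: "('v, 'e, 'z) ordered_bratteli_scheme \<Rightarrow> nat \<Rightarrow> 'e" where
  "x_max B = (THE x. x \<in> path_space B \<and> (\<forall>n. x n \<in> max_edges B))"

definition succ_edge :: "('v, 'e, 'z) ordered_bratteli_scheme \<Rightarrow> 'e \<Rightarrow> 'e" where
  "succ_edge B e = (THE f. f \<in> all_edges B \<and> rng B f = rng B e \<and>
     (e, f) \<in> edge_order B \<and> f \<noteq> e \<and>
     (\<forall>g\<in>all_edges B. (e, g) \<in> edge_order B \<and> g \<noteq> e \<longrightarrow> (f, g) \<in> edge_order B))"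

text \<open>Because of the index shift in infinite paths, \<open>k\<close> below is the usual (1-based) index
  minus one, so the initial segment that is replaced by minimal edges has length \<open>k\<close>.  The
  condition \<open>p @ [f] \<in> paths B 0 (Suc k)\<close> says that \<open>p\<close> is a path from the top vertex to the
  source of \<open>f\<close>; it also covers the empty \<open>p\<close>.\<close>

definition vershik :: "('v, 'e, 'z) ordered_bratteli_scheme \<Rightarrow> (nat \<Rightarrow> 'e) \<Rightarrow> nat \<Rightarrow> 'e" where
  "vershik B x =
     (if x = x_max B then x_min B
      else let k = (LEAST k. x k \<notin> max_edges B);
               f = succ_edge B (x k);
               p = (THE p. p @ [f] \<in> paths B 0 (Suc k) \<and> set p \<subseteq> min_edges B)
           in (\<lambda>n. if n < k then p ! n else if n = k then f else x n))"

text \<open>Integer iterates of a bijection \<open>f\<close> of the set \<open>A\<close> onto itself.\<close>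

definition int_iterate :: "'a set \<Rightarrow> ('a \<Rightarrow> 'a) \<Rightarrow> int \<Rightarrow> 'a \<Rightarrow> 'a" where
  "int_iterate A f n = (if 0 \<le> n then f ^^ nat n else inv_into A f ^^ nat (- n))"

abbreviation vershik_iterate ::
  "('v, 'e, 'z) ordered_bratteli_scheme \<Rightarrow> int \<Rightarrow> (nat \<Rightarrow> 'e) \<Rightarrow> nat \<Rightarrow> 'e" where
  "vershik_iterate B \<equiv> int_iterate (path_space B) (vershik B)"

definition trunc :: "nat \<Rightarrow> (nat \<Rightarrow> 'e) \<Rightarrow> 'e list" where
  "trunc k x = map x [0..<k]"

definition factor_map ::
  "('v, 'e, 'z) ordered_bratteli_scheme \<Rightarrow> nat \<Rightarrow> (nat \<Rightarrow> 'e) \<Rightarrow> int \<Rightarrow> 'e list" where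
  "factor_map B k x = (\<lambda>n. trunc k (vershik_iterate B n x))"

definition factor_space ::
  "('v, 'e, 'z) ordered_bratteli_scheme \<Rightarrow> nat \<Rightarrow> (int \<Rightarrow> 'e list) set" where
  "factor_space B k = factor_map B k ` path_space B"

definition left_shift :: "(int \<Rightarrow> 'a) \<Rightarrow> int \<Rightarrow> 'a" where
  "left_shift w = (\<lambda>n. w (n + 1))"

definition periodic_subshift :: "(int \<Rightarrow> 'a) set \<Rightarrow> bool" where
  "periodic_subshift Y \<longleftrightarrow>
     finite Y \<and> (\<exists>w\<in>Y. Y = range (\<lambda>n. int_iterate Y left_shift n w))"

definition compatible ::
  "('v, 'e, 'z) ordered_bratteli_scheme \<Rightarrow> nat \<Rightarrow> (nat \<Rightarrow> 'e) \<Rightarrow> (nat \<Rightarrow> 'e) \<Rightarrow> bool" where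
  "compatible B i x x' \<longleftrightarrow>
     x \<in> path_space B \<and> x' \<in> path_space B \<and> x \<noteq> x' \<and> factor_map B i x = factor_map B i x'"

definition common_cut ::
  "('v, 'e, 'z) ordered_bratteli_scheme \<Rightarrow> nat \<Rightarrow> (nat \<Rightarrow> 'e) \<Rightarrow> (nat \<Rightarrow> 'e) \<Rightarrow> bool" where
  "common_cut B j x x' \<longleftrightarrow>
     (\<exists>m::int. set (trunc j (vershik_iterate B m x)) \<subseteq> min_edges B \<and>
               set (trunc j (vershik_iterate B m x')) \<subseteq> min_edges B)"

end

theory Submission
  imports Defs "HOL-Library.List_Lexorder"
begin

text \<open>
  Let \<open>w\<close> be the common image of the given points in \<open>X\<^sub>i\<close>. Each of them cuts the time axis
  into tiles, one between any two consecutive cuts at level \<open>j\<close>. The word that \<open>w\<close> carries on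
  a tile is determined by the vertex of level \<open>j\<close> which the point passes during that tile,
  because the map moves through the paths to a fixed vertex in increasing order, starting from
  the minimal one. Look at a time \<open>n\<close>. As \<open>K < (K - 1) 2\<^sup>K + 2\<close>, there are more points than
  vertices of level \<open>j\<close>, so two points have tiles of the same type around \<open>n\<close>. These tiles
  do not start at the same time, as there are no common cuts, so the same word is read off \<open>w\<close> at two places that
  differ by a positive shift \<open>d\<close>, and \<open>n\<close> lies in both occurrences. This makes a square of
  half-length \<open>d\<close> centred at \<open>n\<close>: \<open>w m = w (m + d)\<close> for \<open>n - d \<le> m < n\<close>
  (\<open>square_at_every_position\<close>). The shift is at most the length of a tile, hence bounded by some
  \<open>N\<close> independent of \<open>n\<close>.

  A word with squares of bounded size centred at all positions contains arbitrarily long subwords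
  with period \<open>N!\<close>; the lexicographically largest subwords are such
  (\<open>bounded_squares_imp_long_periodic_subwords\<close>). Periodicity spreads from \<open>w\<close> to all of
  \<open>X\<^sub>i\<close> by uniform recurrence: each finite window of each point of \<open>X\<close> recurs with bounded gaps
  in the orbit of each other point, hence inside every long enough periodic stretch of \<open>w\<close>
  (\<open>long_periodic_windows_imp_periodic_subshift\<close>). So all elements of \<open>X\<^sub>i\<close> have period \<open>N!\<close>
  and are shifts of \<open>w\<close>.

  The dynamical input is that the map is bijective (\<open>vershik_bij\<close>), continuous
  (\<open>vershik_continuous\<close>) and uniformly recurrent (\<open>uniformly_recurrent\<close>), and that tiles have
  bounded length. The last two use a mixed-radix numbering of the initial
  segments of a path that increases strictly until a maximal segment is reached.\<close>

section \<open>Integer iterates of a bijection\<close>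

lemma int_iterate_0 [simp]: "int_iterate A f 0 x = x"
  by (simp add: int_iterate_def)

lemma int_iterate_of_nat: "int_iterate A f (int n) x = (f ^^ n) x"
  by (simp add: int_iterate_def)

lemma int_iterate_in:
  assumes "bij_betw f A A" "x \<in> A"
  shows "int_iterate A f n x \<in> A"
proof -
  have f: "y \<in> A \<Longrightarrow> f y \<in> A" and g: "y \<in> A \<Longrightarrow> inv_into A f y \<in> A" for y
    using assms(1) by (auto simp: bij_betw_def inv_into_into)
  have "(f ^^ k) x \<in> A" "(inv_into A f ^^ k) x \<in> A" for k
    by (induction k) (use f g assms(2) in auto)
  then show ?thesis by (simp add: int_iterate_def)
qed

lemma int_iterate_step:
  assumes "bij_betw f A A" "x \<in> A"
  shows "int_iterate A f (n + 1) x = f (int_iterate A f n x)"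
proof (cases "n \<ge> 0")
  case True
  then show ?thesis by (simp add: int_iterate_def nat_add_distrib)
next
  case False
  then have "nat (- n) = Suc (nat (- (n + 1)))" by simp
  then have "int_iterate A f n x = inv_into A f (int_iterate A f (n + 1) x)"
    using False by (cases "n + 1 = 0") (auto simp: int_iterate_def)
  then show ?thesis
    using int_iterate_in[OF assms, of "n + 1"] assms(1)
    by (simp add: bij_betw_def f_inv_into_f)
qed

lemma int_iterate_add:
  assumes "bij_betw f A A" "x \<in> A"
  shows "int_iterate A f (m + n) x = int_iterate A f m (int_iterate A f n x)"
proof (induction m rule: int_induct[where k = 0])
  case base
  then show ?case by simp
next
  case (step1 i)
  then show ?case
    using int_iterate_step[OF assms, of "i + n"]
      int_iterate_step[OF assms(1) int_iterate_in[OF assms], of i n]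
    by (simp add: algebra_simps)
next
  case (step2 i)
  have "f (int_iterate A f (i - 1 + n) x) = f (int_iterate A f (i - 1) (int_iterate A f n x))"
    using step2 int_iterate_step[OF assms, of "i - 1 + n"]
      int_iterate_step[OF assms(1) int_iterate_in[OF assms], of "i - 1" n]
    by simp
  then show ?case
    using assms int_iterate_in[OF assms] int_iterate_in[OF assms(1)]
    by (meson bij_betw_def inj_on_contraD)
qed

lemma int_iterate_left_shift:
  assumes bij: "bij_betw left_shift Y Y" and "w \<in> Y"
  shows "int_iterate Y left_shift n w = (\<lambda>m. w (m + n))"
proof (induction n rule: int_induct[where k = 0])
  case base
  then show ?case by simp
next
  case (step1 i)
  have "int_iterate Y left_shift (i + 1) w = left_shift (\<lambda>m. w (m + i))"
    using int_iterate_step[OF assms, of i] step1 by simp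
  moreover have "left_shift (\<lambda>m. w (m + i)) = (\<lambda>m. w (m + (i + 1)))"
    by (simp add: left_shift_def algebra_simps)
  ultimately show ?case by simp
next
  case (step2 i)
  have "int_iterate Y left_shift i w m = int_iterate Y left_shift (i - 1) w (m + 1)" for m
    using int_iterate_step[OF assms, of "i - 1"] by (simp add: left_shift_def)
  then have *: "w (m + i) = int_iterate Y left_shift (i - 1) w (m + 1)" for m
    using step2 by metis
  show ?case
  proof
    fix m show "int_iterate Y left_shift (i - 1) w m = w (m + (i - 1))"
      using *[of "m - 1"] by (simp add: algebra_simps)
  qed
qed


section \<open>Periodicity of two-sided words\<close>

lemma take_lex_mono:
  fixes u v :: "'a::linorder list"
  assumes "length u = length v" "u \<le> v"
  shows "take k u \<le> take k v"
  using assms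
proof (induction u v arbitrary: k rule: list_induct2)
  case (Cons x xs y ys)
  then show ?case by (cases k) auto
qed simp

lemma append_lex_cancel: "s @ u \<le> s @ v \<longleftrightarrow> u \<le> (v :: 'a::linorder list)"
  by (induction s) auto

definition subword :: "(int \<Rightarrow> 'a) \<Rightarrow> int \<Rightarrow> nat \<Rightarrow> 'a list" where
  "subword w q n = map (\<lambda>t. w (q + int t)) [0..<n]"

lemma length_subword [simp]: "length (subword w q n) = n"
  by (simp add: subword_def)

lemma nth_subword: "t < n \<Longrightarrow> subword w q n ! t = w (q + int t)"
  by (simp add: subword_def)

lemma take_subword: "k \<le> n \<Longrightarrow> take k (subword w q n) = subword w q k"
  by (rule nth_equalityI) (auto simp: nth_subword)

lemma subword_append: "subword w q (k + l) = subword w q k @ subword w (q + int k) l"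
  by (rule nth_equalityI) (auto simp: nth_subword nth_append)

lemma finite_subwords:
  assumes "finite (range w)"
  shows "finite (range (\<lambda>q. subword w q n))"
proof (rule finite_subset)
  show "range (\<lambda>q. subword w q n) \<subseteq> {xs. set xs \<subseteq> range w \<and> length xs = n}"
    by (auto simp: subword_def)
qed (simp add: assms finite_lists_length_eq)

text \<open>
  Let \<open>m\<^sub>n\<close> be the lexicographically largest subword of length \<open>n\<close>. Each \<open>m\<^sub>k\<close> is a prefix of
  \<open>m\<^sub>n\<close> for \<open>k \<le> n\<close>. If \<open>m\<^sub>n\<close> starts at position \<open>q\<close> and the square at \<open>q\<close> is \<open>s s\<close>, then
  \<open>m\<^sub>n = s t\<close> with \<open>|s| = d\<close>, and \<open>s m\<^bsub>n-d\<^esub>\<close> is the subword starting \<open>d\<close> places earlier, so \<open>s m\<^bsub>n-d\<^esub> \<le> s t\<close>.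
  Hence \<open>m\<^bsub>n-d\<^esub> \<le> t\<close>, and \<open>t = m\<^bsub>n-d\<^esub>\<close> by maximality: \<open>m\<^sub>n\<close> has period \<open>d\<close>. As \<open>d\<close>
  depends on \<open>n\<close>, the common multiple \<open>N!\<close> of all candidates is taken as the period.\<close>

lemma bounded_squares_imp_long_periodic_subwords_nat:
  fixes w :: "int \<Rightarrow> nat"
  assumes fin: "finite (range w)"
    and sq: "\<And>n. \<exists>d\<ge>1. d \<le> N \<and> (\<forall>m. n - int d \<le> m \<and> m < n \<longrightarrow> w m = w (m + int d))"
  shows "\<exists>q. \<forall>t<l. w (q + int t) = w (q + int t + int (fact N))"
proof -
  define M where "M n = Max (range (\<lambda>q. subword w q n))" for n
  have M_ge: "subword w q n \<le> M n" for q n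
    unfolding M_def by (rule Max_ge[OF finite_subwords[OF fin]]) auto
  have "M n \<in> range (\<lambda>q. subword w q n)" for n
    unfolding M_def by (rule Max_in[OF finite_subwords[OF fin]]) auto
  then have M_ex: "\<exists>q. M n = subword w q n" for n by auto
  have pre: "take k (M n) = M k" if "k \<le> n" for k n
  proof (rule antisym)
    obtain q where "M n = subword w q n" using M_ex by blast
    then show "take k (M n) \<le> M k" using M_ge take_subword[OF that] by metis
  next
    obtain q where q: "M k = subword w q k" using M_ex by blast
    obtain q' where q': "M n = subword w q' n" using M_ex by blast
    have "take k (subword w q n) \<le> take k (M n)"
      by (rule take_lex_mono) (simp add: q', rule M_ge)
    then show "M k \<le> take k (M n)" using q take_subword[OF that] by metis
  qed
  \<comment> \<open>Long enough for the square at its start and for \<open>l\<close> comparisons at distance \<open>N!\<close>.\<close>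
  define n where "n = N + fact N + l"
  obtain q where q: "M n = subword w q n" using M_ex by blast
  obtain d where d: "d \<ge> 1" "d \<le> N" and dd: "\<And>m. q - int d \<le> m \<and> m < q \<Longrightarrow> w m = w (m + int d)"
    using sq by blast
  have dn: "n = d + (n - d)" "d \<le> n" using d n_def by auto
  have s: "subword w (q - int d) d = subword w q d"
  proof (rule nth_equalityI, simp, clarsimp simp: nth_subword)
    fix t assume "t < d" then show "w (q - int d + int t) = w (q + int t)"
      using dd[of "q - int d + int t"] by (simp add: algebra_simps)
  qed
  have pre': "subword w q (n - d) = M (n - d)"
    using pre[of "n - d" n] q take_subword[of "n - d" n w q] by simp
  have "subword w (q - int d) n \<le> subword w q n" using M_ge q by metis
  then have "subword w q d @ subword w q (n - d) \<le> subword w q d @ subword w (q + int d) (n - d)"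
    using s subword_append[of w "q - int d" d "n - d"] subword_append[of w q d "n - d"] dn by simp
  then have "M (n - d) \<le> subword w (q + int d) (n - d)"
    unfolding append_lex_cancel pre' .
  then have e: "subword w (q + int d) (n - d) = subword w q (n - d)"
    using M_ge pre' by (metis antisym)
  have per: "w (q + int t) = w (q + int t + int d)" if "t + d < n" for t
    using that arg_cong[OF e, of "\<lambda>u. u ! t"] by (simp add: nth_subword algebra_simps)
  have per': "w (q + int t) = w (q + int t + int (c * d))" if "t + c * d < n" for t c
    using that
  proof (induction c)
    case (Suc c)
    then show ?case using per[of "t + c * d"] by (simp add: algebra_simps)
  qed simp
  obtain c where c: "fact N = c * d"
    using dvd_fact[OF d] by (metis dvd_def mult.commute)
  have "w (q + int t) = w (q + int t + int (fact N))" if "t < l" for t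
    using per'[of t c] that unfolding c[symmetric] n_def by simp
  then show ?thesis by blast
qed

text \<open>
  Any linear order on the letters will do for the lexicographic choice, so an injective numbering of
  the finitely many letters reduces this to words over \<open>nat\<close>.\<close>

lemma bounded_squares_imp_long_periodic_subwords:
  fixes w :: "int \<Rightarrow> 'a"
  assumes fin: "finite (range w)"
    and sq: "\<And>n. \<exists>d\<ge>1. d \<le> N \<and> (\<forall>m. n - int d \<le> m \<and> m < n \<longrightarrow> w m = w (m + int d))"
  shows "\<exists>q. \<forall>t<l. w (q + int t) = w (q + int t + int (fact N))"
proof -
  obtain \<phi> :: "'a \<Rightarrow> nat" where \<phi>: "inj_on \<phi> (range w)"
    using finite_imp_inj_to_nat_seg[OF fin] by blast
  have "finite (range (\<phi> \<circ> w))" using fin by (metis finite_imageI image_comp)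
  moreover have "\<exists>d\<ge>1. d \<le> N \<and> (\<forall>m. n - int d \<le> m \<and> m < n \<longrightarrow> (\<phi> \<circ> w) m = (\<phi> \<circ> w) (m + int d))" for n
    using sq[of n] by (metis comp_apply)
  ultimately obtain q where "\<forall>t<l. (\<phi> \<circ> w) (q + int t) = (\<phi> \<circ> w) (q + int t + int (fact N))"
    using bounded_squares_imp_long_periodic_subwords_nat[of "\<phi> \<circ> w" N l] by blast
  then show ?thesis using \<phi> by (auto simp: inj_on_def)
qed

lemma int_periodic_mod:
  fixes g :: "int \<Rightarrow> 'b"
  assumes "\<And>m. g (m + p) = g m" shows "g (m mod p) = g m"
proof -
  have "g (m + p * c) = g m" for m c
  proof (induction c rule: int_induct[where k = 0])
    case (step1 c)
    then show ?case using assms[of "m + p * c"] by (simp add: algebra_simps)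
  next
    case (step2 c)
    then show ?case using assms[of "m + p * (c - 1)"] by (simp add: algebra_simps)
  qed simp
  from this[of "m mod p" "m div p"] show ?thesis by simp
qed

section \<open>Least elements and limit points\<close>

lemma finite_total_has_least:
  assumes "finite S" "S \<noteq> {}" "trans R" "\<And>a b. a \<in> S \<Longrightarrow> b \<in> S \<Longrightarrow> (a, b) \<in> R \<or> (b, a) \<in> R"
  shows "\<exists>f\<in>S. \<forall>g\<in>S. (f, g) \<in> R"
  using assms(1,2,4)
proof (induction S rule: finite_ne_induct)
  case (insert a S)
  then obtain f where f: "f \<in> S" "\<forall>g\<in>S. (f, g) \<in> R" by blast
  show ?case
  proof (cases "(f, a) \<in> R")
    case True
    then show ?thesis using f by blast
  next
    case False
    then have "(a, f) \<in> R" using insert.prems f(1) by blast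
    moreover have "(a, a) \<in> R" using insert.prems by blast
    ultimately show ?thesis using f(2) transD[OF assms(3)] by blast
  qed
qed auto

text \<open>
  Koenig's lemma for a sequence of infinite paths: the coordinates of the limit are fixed one after
  the other, each time by passing to an infinite set of indices.\<close>

lemma limit_point_of_finite_branching:
  assumes fin: "\<And>n. finite (F n)" and Z: "\<And>k n. Z k n \<in> F n"
  shows "\<exists>x. \<forall>l. infinite {k::nat. \<forall>n<(l::nat). Z k n = x n}"
proof -
  have "\<exists>f. \<forall>l::nat. infinite {k::nat. \<forall>n<l. Z k n = f l n} \<and> (\<forall>n<l. f (Suc l) n = f l n)"
  proof (rule dependent_nat_choice)
    show "\<exists>x. infinite {k::nat. \<forall>n<(0::nat). Z k n = x n}" by simp
  next
    fix x l assume inf: "infinite {k::nat. \<forall>n<l. Z k n = x n}" (is "infinite ?S")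
    \<comment> \<open>Infinitely many of the remaining indices share the value of the next coordinate.\<close>
    have "finite ((\<lambda>k. Z k l) ` ?S)"
      by (rule finite_subset[OF _ fin[of l]]) (use Z in auto)
    then obtain k0 where k0: "infinite {k \<in> ?S. Z k l = Z k0 l}"
      using pigeonhole_infinite[OF inf] by blast
    have "{k \<in> ?S. Z k l = Z k0 l} \<subseteq> {k. \<forall>n<Suc l. Z k n = (x(l := Z k0 l)) n}"
      by (auto simp: less_Suc_eq)
    then have "infinite {k. \<forall>n<Suc l. Z k n = (x(l := Z k0 l)) n}"
      using k0 infinite_super by blast
    moreover have "\<forall>n<l. (x(l := Z k0 l)) n = x n" by simp
    ultimately show "\<exists>y. infinite {k. \<forall>n<Suc l. Z k n = y n} \<and> (\<forall>n<l. y n = x n)"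
      by blast
  qed
  then obtain f where f: "\<And>l. infinite {k. \<forall>n<l. Z k n = f l n}"
    and step: "\<And>l n. n < l \<Longrightarrow> f (Suc l) n = f l n" by blast
  have stable: "f l n = f (Suc n) n" if "n < l" for l n
    using that by (induction l) (auto simp: less_Suc_eq step)
  have "infinite {k. \<forall>n<l. Z k n = f (Suc n) n}" for l :: nat
  proof -
    have "{k. \<forall>n<l. Z k n = f (Suc n) n} = {k. \<forall>n<l. Z k n = f l n}"
      using stable[of _ l] by (intro Collect_cong) metis
    then show ?thesis using f by simp
  qed
  then show ?thesis by (intro exI[of _ "\<lambda>n. f (Suc n) n"] allI)
qed

section \<open>Edges and paths of a properly ordered diagram\<close>

locale bratteli_vershik =
  fixes B :: "('v, 'e, 'z) ordered_bratteli_scheme"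
  assumes proper: "properly_ordered B"
begin

abbreviation "V \<equiv> verts B"
abbreviation "E \<equiv> edges B"
abbreviation "s \<equiv> src B"
abbreviation "r \<equiv> rng B"
abbreviation "X \<equiv> path_space B"
abbreviation "T \<equiv> vershik B"
abbreviation "all_min k x \<equiv> \<forall>n<k. x n \<in> min_edges B"
abbreviation "all_max k x \<equiv> \<forall>n<k. x n \<in> max_edges B"
abbreviation "agree k x y \<equiv> \<forall>n<(k::nat). x n = y n"

lemma ordered: "ordered_bratteli_diagram B" and simple: "simple_diagram B"
  using proper by (auto simp: properly_ordered_def)

lemma diagram: "bratteli_diagram B"
  using ordered by (simp add: ordered_bratteli_diagram_def)

lemma V_disjoint: "v \<in> V m \<Longrightarrow> v \<in> V n \<Longrightarrow> m = n"
  using diagram unfolding bratteli_diagram_def by blast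

lemma V0_unique: "u \<in> V 0 \<Longrightarrow> v \<in> V 0 \<Longrightarrow> u = v"
  using diagram unfolding bratteli_diagram_def by auto

lemma finite_V: "finite (V n)"
  using diagram unfolding bratteli_diagram_def by auto

lemma finite_E: "finite (E (Suc n))"
  using diagram unfolding bratteli_diagram_def by auto

lemma src_in: "e \<in> E (Suc n) \<Longrightarrow> s e \<in> V n"
  using diagram unfolding bratteli_diagram_def by (metis diff_Suc_1 le_add1 plus_1_eq_Suc)

lemma rng_in: "e \<in> E (Suc n) \<Longrightarrow> r e \<in> V (Suc n)"
  using diagram unfolding bratteli_diagram_def by (metis le_add1 plus_1_eq_Suc)

lemma all_edges_iff: "e \<in> all_edges B \<longleftrightarrow> (\<exists>n. e \<in> E (Suc n))"
  unfolding all_edges_def by (auto, metis Suc_pred less_eq_Suc_le)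

lemma edge_level: "e \<in> all_edges B \<Longrightarrow> r e \<in> V (Suc n) \<Longrightarrow> e \<in> E (Suc n)"
  unfolding all_edges_iff using rng_in V_disjoint by blast

lemma incoming_edge:
  assumes "v \<in> V (Suc n)" shows "\<exists>e\<in>E (Suc n). r e = v"
proof -
  have "v \<notin> V 0" using V_disjoint[OF assms, of 0] by auto
  then have "v \<in> all_verts B - V 0" using assms by (auto simp: all_verts_def)
  moreover have "\<forall>v\<in>all_verts B - V 0. \<exists>e\<in>all_edges B. r e = v"
    using diagram unfolding bratteli_diagram_def by (elim conjE)
  ultimately obtain e where "e \<in> all_edges B" "r e = v" by blast
  then show ?thesis using edge_level assms by blast
qed

lemma finite_fibre:
  assumes "e \<in> all_edges B" shows "finite {g \<in> all_edges B. r g = r e}"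
proof -
  obtain n where "e \<in> E (Suc n)" using assms all_edges_iff by blast
  then have "{g \<in> all_edges B. r g = r e} \<subseteq> E (Suc n)" using edge_level rng_in by fastforce
  then show ?thesis using finite_E finite_subset by blast
qed

lemma edge_order_trans: "trans (edge_order B)" and edge_order_antisym: "antisym (edge_order B)"
  using ordered by (auto simp: ordered_bratteli_diagram_def partial_order_on_def preorder_on_def)

lemma comparable_iff:
  "e \<in> all_edges B \<Longrightarrow> f \<in> all_edges B \<Longrightarrow>
    (e, f) \<in> edge_order B \<or> (f, e) \<in> edge_order B \<longleftrightarrow> r e = r f"
  using ordered by (auto simp: ordered_bratteli_diagram_def)

lemma min_unique_in_fibre: "e \<in> min_edges B \<Longrightarrow> f \<in> min_edges B \<Longrightarrow> r e = r f \<Longrightarrow> e = f"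
  using comparable_iff unfolding min_edges_def by blast

lemma max_unique_in_fibre: "e \<in> max_edges B \<Longrightarrow> f \<in> max_edges B \<Longrightarrow> r e = r f \<Longrightarrow> e = f"
  using comparable_iff unfolding max_edges_def by blast

lemma fibre_has_least:
  assumes "S \<subseteq> {g \<in> all_edges B. r g = v}" "S \<noteq> {}"
  shows "\<exists>f\<in>S. \<forall>g\<in>S. (f, g) \<in> edge_order B"
proof (rule finite_total_has_least)
  obtain e where "e \<in> S" using assms(2) by blast
  then have "e \<in> all_edges B" "S \<subseteq> {g \<in> all_edges B. r g = r e}" using assms(1) by auto
  then show "finite S" using finite_fibre finite_subset by blast
qed (use assms edge_order_trans comparable_iff in auto)

lemma fibre_has_greatest:
  assumes "S \<subseteq> {g \<in> all_edges B. r g = v}" "S \<noteq> {}"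
  shows "\<exists>f\<in>S. \<forall>g\<in>S. (g, f) \<in> edge_order B"
proof -
  have "\<exists>f\<in>S. \<forall>g\<in>S. (f, g) \<in> (edge_order B)\<inverse>"
  proof (rule finite_total_has_least)
    obtain e where "e \<in> S" using assms(2) by blast
    then have "e \<in> all_edges B" "S \<subseteq> {g \<in> all_edges B. r g = r e}" using assms(1) by auto
    then show "finite S" using finite_fibre finite_subset by blast
  qed (use assms edge_order_trans comparable_iff in auto)
  then show ?thesis by simp
qed

lemma min_edge_exists:
  assumes "v \<in> V (Suc n)" shows "\<exists>e\<in>E (Suc n). e \<in> min_edges B \<and> r e = v"
proof -
  let ?S = "{g \<in> all_edges B. r g = v}"
  have "?S \<noteq> {}" using incoming_edge[OF assms] all_edges_iff by blast
  then obtain e where e: "e \<in> ?S" "\<forall>g\<in>?S. (e, g) \<in> edge_order B"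
    using fibre_has_least[of ?S v] by blast
  have "e \<in> min_edges B"
    unfolding min_edges_def using e comparable_iff antisymD[OF edge_order_antisym] by blast
  then show ?thesis using e edge_level assms by blast
qed

lemma max_edge_exists:
  assumes "v \<in> V (Suc n)" shows "\<exists>e\<in>E (Suc n). e \<in> max_edges B \<and> r e = v"
proof -
  let ?S = "{g \<in> all_edges B. r g = v}"
  have "?S \<noteq> {}" using incoming_edge[OF assms] all_edges_iff by blast
  then obtain e where e: "e \<in> ?S" "\<forall>g\<in>?S. (g, e) \<in> edge_order B"
    using fibre_has_greatest[of ?S v] by blast
  have "e \<in> max_edges B"
    unfolding max_edges_def using e comparable_iff antisymD[OF edge_order_antisym] by blast
  then show ?thesis using e edge_level assms by blast
qed

text \<open>
  The property by which \<^const>\<open>succ_edge\<close> is defined as a definite description. As a relation it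
  can be read from either side, which is what injectivity and surjectivity of the map require.\<close>

definition is_succ :: "'e \<Rightarrow> 'e \<Rightarrow> bool" where
  "is_succ e f \<longleftrightarrow> f \<in> all_edges B \<and> r f = r e \<and> (e, f) \<in> edge_order B \<and> f \<noteq> e \<and>
     (\<forall>g\<in>all_edges B. (e, g) \<in> edge_order B \<and> g \<noteq> e \<longrightarrow> (f, g) \<in> edge_order B)"

lemma is_succ_unique: "is_succ e f \<Longrightarrow> is_succ e g \<Longrightarrow> f = g"
  unfolding is_succ_def using antisymD[OF edge_order_antisym] by blast

lemma succ_edge_eqI: "is_succ e f \<Longrightarrow> succ_edge B e = f"
  unfolding succ_edge_def is_succ_def[symmetric] using is_succ_unique by (blast intro: the_equality)

lemma is_succ_succ_edge:
  assumes "e \<in> all_edges B" "e \<notin> max_edges B"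
  shows "is_succ e (succ_edge B e)"
proof -
  let ?S = "{g \<in> all_edges B. (e, g) \<in> edge_order B \<and> g \<noteq> e}"
  have "?S \<noteq> {}" using assms unfolding max_edges_def by blast
  moreover have "?S \<subseteq> {g \<in> all_edges B. r g = r e}" using comparable_iff assms(1) by blast
  ultimately obtain f where "f \<in> ?S" "\<forall>g\<in>?S. (f, g) \<in> edge_order B"
    using fibre_has_least by blast
  then have "is_succ e f" unfolding is_succ_def using comparable_iff assms(1) by blast
  then show ?thesis using succ_edge_eqI by metis
qed

lemma is_succ_pred_exists:
  assumes "f \<in> all_edges B" "f \<notin> min_edges B"
  shows "\<exists>e\<in>all_edges B. is_succ e f"
proof -
  let ?S = "{g \<in> all_edges B. (g, f) \<in> edge_order B \<and> g \<noteq> f}"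
  have "?S \<noteq> {}" using assms unfolding min_edges_def by blast
  moreover have "?S \<subseteq> {g \<in> all_edges B. r g = r f}" using comparable_iff assms(1) by blast
  ultimately obtain e where e: "e \<in> ?S" "\<forall>g\<in>?S. (g, e) \<in> edge_order B"
    using fibre_has_greatest by blast
  have "(f, g) \<in> edge_order B" if "g \<in> all_edges B" "(e, g) \<in> edge_order B" "g \<noteq> e" for g
  proof -
    have "r g = r e" "r e = r f"
      using comparable_iff[of e g] comparable_iff[of e f] that e(1) assms(1) by auto
    then have "(f, g) \<in> edge_order B \<or> (g, f) \<in> edge_order B"
      using comparable_iff[OF assms(1) that(1)] by simp
    moreover have "(f, f) \<in> edge_order B" using comparable_iff[OF assms(1) assms(1)] by simp
    moreover have "g = f" if gf: "(g, f) \<in> edge_order B"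
    proof (rule ccontr)
      assume "g \<noteq> f"
      then have "(g, e) \<in> edge_order B" using e(2) gf \<open>g \<in> all_edges B\<close> by blast
      then show False
        using antisymD[OF edge_order_antisym] \<open>(e, g) \<in> edge_order B\<close> \<open>g \<noteq> e\<close> by blast
    qed
    ultimately show ?thesis by blast
  qed
  then show ?thesis unfolding is_succ_def using e comparable_iff assms(1) by blast
qed

lemma is_succ_not_max: "e \<in> all_edges B \<Longrightarrow> is_succ e f \<Longrightarrow> e \<notin> max_edges B"
  unfolding is_succ_def max_edges_def by blast

lemma is_succ_not_min: "e \<in> all_edges B \<Longrightarrow> is_succ e f \<Longrightarrow> f \<notin> min_edges B"
  unfolding is_succ_def min_edges_def by blast

lemma is_succ_inj:
  assumes "e \<in> all_edges B" "e' \<in> all_edges B" "is_succ e f" "is_succ e' f"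
  shows "e = e'"
proof (rule ccontr)
  assume ne: "e \<noteq> e'"
  have "r e = r e'" using assms unfolding is_succ_def by simp
  then have "(e, e') \<in> edge_order B \<or> (e', e) \<in> edge_order B"
    using comparable_iff assms by blast
  then have "(f, e') \<in> edge_order B \<or> (f, e) \<in> edge_order B"
    using assms ne unfolding is_succ_def by blast
  then show False using assms antisymD[OF edge_order_antisym] unfolding is_succ_def by blast
qed

lemma X_edge: "x \<in> X \<Longrightarrow> x n \<in> E (Suc n)" and X_link: "x \<in> X \<Longrightarrow> r (x n) = s (x (Suc n))"
  by (auto simp: path_space_def)

lemma X_all_edges: "x \<in> X \<Longrightarrow> x n \<in> all_edges B"
  using X_edge all_edges_iff by blast

text \<open>
  An infinite path may be rerouted through any finite path that joins it to the tail of another.\<close>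

lemma splice:
  assumes x: "x \<in> X" and y: "y \<in> X" and c: "c \<in> paths B k l" and kl: "k < l"
    and left: "s (c ! 0) = s (x k)" and right: "r (c ! (l - k - 1)) = s (y l)"
  shows "(\<lambda>n. if n < k then x n else if n < l then c ! (n - k) else y n) \<in> X" (is "?z \<in> X")
proof -
  have len: "length c = l - k"
    and ce: "\<And>t. t < l - k \<Longrightarrow> c ! t \<in> E (k + 1 + t)"
    and cl: "\<And>t. Suc t < l - k \<Longrightarrow> r (c ! t) = s (c ! Suc t)"
    using c by (auto simp: paths_def)
  have "?z n \<in> E (Suc n)" for n
    using X_edge[OF x, of n] X_edge[OF y, of n] ce[of "n - k"] kl by auto
  moreover have "r (?z n) = s (?z (Suc n))" for n
  proof -
    consider "Suc n < k" | "Suc n = k" | "k \<le> n" "Suc n < l" | "k \<le> n" "Suc n = l" | "l \<le> n"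
      by linarith
    then show ?thesis
    proof cases
      case 3
      then show ?thesis using cl[of "n - k"] by (simp add: Suc_diff_le)
    next
      case 4
      then show ?thesis using right by (auto simp: Suc_diff_le)
    qed (use X_link[OF x, of n] X_link[OF y, of n] left kl in auto)
  qed
  ultimately show ?thesis by (simp add: path_space_def)
qed

lemma splice_initial:
  assumes y: "y \<in> X" and c: "c \<in> paths B 0 (Suc k)" and right: "r (c ! k) = s (y (Suc k))"
  shows "(\<lambda>n. if n < Suc k then c ! n else y n) \<in> X"
proof -
  have "c ! 0 \<in> E (Suc 0)" using c by (auto simp: paths_def)
  then have "s (c ! 0) = s (y 0)" using X_edge[OF y, of 0] src_in V0_unique by blast
  then show ?thesis using splice[OF y y c] right by (simp cong: if_cong)
qed

lemma paths_snoc: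
  assumes "p @ [e] \<in> paths B 0 (Suc k)" "f \<in> E (Suc (Suc k))" "r e = s f"
  shows "p @ [e, f] \<in> paths B 0 (Suc (Suc k))"
proof -
  let ?q = "p @ [e, f]"
  have len: "length p = k" and ce: "\<And>t. t < Suc k \<Longrightarrow> (p @ [e]) ! t \<in> E (Suc t)"
    and cl: "\<And>t. Suc t < Suc k \<Longrightarrow> r ((p @ [e]) ! t) = s ((p @ [e]) ! Suc t)"
    using assms(1) by (auto simp: paths_def)
  have eq: "?q ! t = (p @ [e]) ! t" if "t < Suc k" for t
    using that len by (auto simp: nth_append)
  have last: "?q ! Suc k = f" using len by (simp add: nth_append)
  have "?q ! t \<in> E (Suc t)" if "t < Suc (Suc k)" for t
    using that assms(2) ce eq last by (cases "t = Suc k") auto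
  moreover have "r (?q ! t) = s (?q ! Suc t)" if "Suc t < Suc (Suc k)" for t
  proof (cases "t = k")
    case True
    then show ?thesis using eq[of k] last len assms(3) by (simp add: nth_append)
  next
    case False
    then show ?thesis using that cl eq by simp
  qed
  ultimately show ?thesis using len by (simp add: paths_def)
qed

lemma paths_initial:
  assumes "p @ [e, f] \<in> paths B 0 (Suc (Suc k))"
  shows "p @ [e] \<in> paths B 0 (Suc k) \<and> r e = s f"
proof -
  let ?q = "p @ [e, f]"
  have len: "length p = k" and ce: "\<And>t. t < Suc (Suc k) \<Longrightarrow> ?q ! t \<in> E (Suc t)"
    and cl: "\<And>t. Suc t < Suc (Suc k) \<Longrightarrow> r (?q ! t) = s (?q ! Suc t)"
    using assms by (auto simp: paths_def)
  have eq: "(p @ [e]) ! t = ?q ! t" if "t < Suc k" for t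
    using that len by (auto simp: nth_append)
  have "p @ [e] \<in> paths B 0 (Suc k)"
    using len ce cl by (auto simp: paths_def eq)
  moreover have "r e = s f" using cl[of k] len by (simp add: nth_append)
  ultimately show ?thesis by simp
qed

text \<open>
  Following minimal (or maximal) incoming edges from a vertex back to the top never involves a choice.
  The next three lemmas are stated for a set \<open>M\<close> of edges so that they serve both cases.\<close>

lemma extremal_path_exists:
  assumes M: "\<And>n v. v \<in> V (Suc n) \<Longrightarrow> \<exists>e\<in>E (Suc n). e \<in> M \<and> r e = v"
    and f: "f \<in> E (Suc k)"
  shows "\<exists>p. p @ [f] \<in> paths B 0 (Suc k) \<and> set p \<subseteq> M"
  using f
proof (induction k arbitrary: f)
  case 0
  then show ?case by (intro exI[of _ "[]"]) (simp add: paths_def)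
next
  case (Suc k)
  then obtain e where e: "e \<in> E (Suc k)" "e \<in> M" "r e = s f" using M src_in by metis
  then obtain p where "p @ [e] \<in> paths B 0 (Suc k)" "set p \<subseteq> M" using Suc.IH by blast
  then show ?case using paths_snoc Suc.prems e by (intro exI[of _ "p @ [e]"]) auto
qed

lemma extremal_path_unique:
  assumes M: "\<And>e f. e \<in> M \<Longrightarrow> f \<in> M \<Longrightarrow> r e = r f \<Longrightarrow> e = f"
    and "p @ [f] \<in> paths B 0 (Suc k)" "set p \<subseteq> M" "q @ [f] \<in> paths B 0 (Suc k)" "set q \<subseteq> M"
  shows "p = q"
  using assms(2-)
proof (induction k arbitrary: f p q)
  case 0
  then show ?case by (simp add: paths_def)
next
  case (Suc k)
  then have "length p = Suc k" "length q = Suc k" by (simp_all add: paths_def)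
  then obtain p' e q' e' where pq: "p = p' @ [e]" "q = q' @ [e']"
    by (metis length_Suc_conv_rev)
  then have 1: "p' @ [e] \<in> paths B 0 (Suc k)" "r e = s f" "q' @ [e'] \<in> paths B 0 (Suc k)" "r e' = s f"
    using Suc.prems paths_initial[of p' e f k] paths_initial[of q' e' f k] by simp_all
  have M': "e \<in> M" "e' \<in> M" "set p' \<subseteq> M" "set q' \<subseteq> M" using pq Suc.prems by auto
  have "e = e'" by (rule M) (simp_all add: M' 1)
  moreover have "p' = q'" by (rule Suc.IH[of p' e q']) (use 1 M' calculation in simp_all)
  ultimately show ?case using pq by simp
qed

lemma extremal_prefix_unique:
  assumes M: "\<And>e f. e \<in> M \<Longrightarrow> f \<in> M \<Longrightarrow> r e = r f \<Longrightarrow> e = f"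
    and "x \<in> X" "y \<in> X" "\<forall>n<k. x n \<in> M" "\<forall>n<k. y n \<in> M" "s (x k) = s (y k)"
  shows "agree k x y"
  using assms(4-)
proof (induction k)
  case (Suc k)
  have "r (x k) = r (y k)"
    using Suc.prems(3) X_link[OF assms(2), of k] X_link[OF assms(3), of k] by simp
  then have e: "x k = y k" by (intro M) (use Suc.prems(1,2) in simp_all)
  have "agree k x y"
  proof (rule Suc.IH)
    show "s (x k) = s (y k)" by (simp add: e)
  qed (use Suc.prems(1,2) in simp_all)
  then show ?case using e by (simp add: less_Suc_eq)
qed simp

lemma min_prefix_unique:
  assumes "x \<in> X" "y \<in> X" "all_min k x" "all_min k y" "s (x k) = s (y k)"
  shows "agree k x y"
  by (rule extremal_prefix_unique[of "min_edges B"]) (use assms min_unique_in_fibre in blast)+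

lemma max_prefix_unique:
  assumes "x \<in> X" "y \<in> X" "all_max k x" "all_max k y" "s (x k) = s (y k)"
  shows "agree k x y"
  by (rule extremal_prefix_unique[of "max_edges B"]) (use assms max_unique_in_fibre in blast)+

lemma min_path_exists_unique:
  assumes "f \<in> E (Suc k)"
  shows "\<exists>!p. p @ [f] \<in> paths B 0 (Suc k) \<and> set p \<subseteq> min_edges B"
proof (rule ex_ex1I)
  show "\<exists>p. p @ [f] \<in> paths B 0 (Suc k) \<and> set p \<subseteq> min_edges B"
    by (rule extremal_path_exists) (use min_edge_exists assms in blast)+
next
  fix p q
  assume "p @ [f] \<in> paths B 0 (Suc k) \<and> set p \<subseteq> min_edges B"
    and "q @ [f] \<in> paths B 0 (Suc k) \<and> set q \<subseteq> min_edges B"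
  then show "p = q"
    using extremal_path_unique[of "min_edges B" p f k q] min_unique_in_fibre by blast
qed

lemma max_path_exists:
  assumes "f \<in> E (Suc k)"
  shows "\<exists>p. p @ [f] \<in> paths B 0 (Suc k) \<and> set p \<subseteq> max_edges B"
  by (rule extremal_path_exists) (use max_edge_exists assms in blast)+

section \<open>The Bratteli-Vershik map is a continuous bijection\<close>

lemma x_min_in: "x_min B \<in> X" "x_min B n \<in> min_edges B"
  using theI'[of "\<lambda>x. x \<in> X \<and> (\<forall>n. x n \<in> min_edges B)"] proper
  by (auto simp: x_min_def properly_ordered_def)

lemma x_max_in: "x_max B \<in> X" "x_max B n \<in> max_edges B"
  using theI'[of "\<lambda>x. x \<in> X \<and> (\<forall>n. x n \<in> max_edges B)"] proper
  by (auto simp: x_max_def properly_ordered_def)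

lemma x_min_unique: "x \<in> X \<Longrightarrow> \<forall>n. x n \<in> min_edges B \<Longrightarrow> x = x_min B"
  using proper x_min_in by (auto simp: properly_ordered_def)

lemma x_max_unique: "x \<in> X \<Longrightarrow> \<forall>n. x n \<in> max_edges B \<Longrightarrow> x = x_max B"
  using proper x_max_in by (auto simp: properly_ordered_def)

lemma vershik_x_max: "T (x_max B) = x_min B"
  by (simp add: vershik_def)

lemma first_failure:
  fixes x :: "nat \<Rightarrow> 'e"
  assumes "\<not> (\<forall>n<k. x n \<in> M)"
  shows "\<exists>j<k. (\<forall>n<j. x n \<in> M) \<and> x j \<notin> M"
proof -
  have "\<exists>n. n < k \<and> x n \<notin> M" using assms by blast
  then obtain j where j: "j < k \<and> x j \<notin> M" and "\<forall>n<j. \<not> (n < k \<and> x n \<notin> M)"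
    unfolding exists_least_iff[of "\<lambda>n. n < k \<and> x n \<notin> M"] by blast
  then have "x n \<in> M" if "n < j" for n using that by (meson less_trans)
  then show ?thesis using j by blast
qed

text \<open>
  These four properties determine \<open>T x\<close>, as a minimal prefix is determined by the vertex where it
  ends. All later arguments about non-maximal points refer to them instead of the definition.\<close>

lemma vershik_at_first_nonmax:
  assumes x: "x \<in> X" and below: "all_max j x" and j: "x j \<notin> max_edges B"
  shows "T x \<in> X" "is_succ (x j) (T x j)" "\<And>n. j < n \<Longrightarrow> T x n = x n" "all_min j (T x)"
proof -
  define f where "f = succ_edge B (x j)"
  define p where "p = (THE p. p @ [f] \<in> paths B 0 (Suc j) \<and> set p \<subseteq> min_edges B)"
  \<comment> \<open>The shape of the definition with the least index and the definite descriptions resolved.\<close>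
  have nmax: "x \<noteq> x_max B" using j x_max_in by metis
  have least: "(LEAST n. x n \<notin> max_edges B) = j"
  proof (rule Least_equality)
    show "j \<le> n" if "x n \<notin> max_edges B" for n using below that not_less by blast
  qed (rule j)
  have Tx: "T x = (\<lambda>n. if n < j then p ! n else if n = j then f else x n)"
    using nmax unfolding vershik_def least Let_def p_def f_def by simp
  have succ: "is_succ (x j) f" unfolding f_def by (rule is_succ_succ_edge[OF X_all_edges[OF x] j])
  then have rf: "r f = r (x j)" and "f \<in> all_edges B" by (auto simp: is_succ_def)
  then have f: "f \<in> E (Suc j)" using edge_level rng_in[OF X_edge[OF x]] by simp
  from theI'[OF min_path_exists_unique[OF f]] have p: "p @ [f] \<in> paths B 0 (Suc j)" "set p \<subseteq> min_edges B"
    by (auto simp: p_def)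
  then have len: "length p = j" by (simp add: paths_def)
  have "T x = (\<lambda>n. if n < Suc j then (p @ [f]) ! n else x n)"
    unfolding Tx using len by (auto simp: nth_append less_Suc_eq)
  moreover have "r ((p @ [f]) ! j) = s (x (Suc j))"
    using len rf X_link[OF x, of j] by (simp add: nth_append)
  ultimately show "T x \<in> X" using splice_initial[OF x p(1)] by simp
  show "is_succ (x j) (T x j)" using succ by (simp add: Tx)
  show "T x n = x n" if "j < n" for n using that by (simp add: Tx)
  show "all_min j (T x)" using len p(2) by (auto simp: Tx)
qed

lemma not_x_max_imp_nonmax:
  assumes "x \<in> X" "x \<noteq> x_max B"
  shows "\<exists>j. all_max j x \<and> x j \<notin> max_edges B"
proof -
  obtain n where "x n \<notin> max_edges B" using x_max_unique assms by blast
  then show ?thesis using first_failure[of "Suc n" x "max_edges B"] by blast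
qed

lemma vershik_in: "x \<in> X \<Longrightarrow> T x \<in> X"
  by (metis not_x_max_imp_nonmax vershik_at_first_nonmax(1) vershik_x_max x_min_in(1))

lemma vershik_all_max_imp_all_min:
  assumes "x \<in> X" "all_max k x" shows "all_min k (T x)"
proof (cases "x = x_max B")
  case True
  then show ?thesis using vershik_x_max x_min_in by simp
next
  case False
  then obtain j where j: "all_max j x" "x j \<notin> max_edges B" using not_x_max_imp_nonmax assms by blast
  then have "k \<le> j" using assms(2) by (meson not_le)
  then show ?thesis using vershik_at_first_nonmax(4)[OF assms(1) j] by simp
qed

lemma vershik_not_all_max:
  assumes "x \<in> X" "\<not> all_max k x" shows "k \<le> n \<Longrightarrow> T x n = x n"
  using first_failure[OF assms(2)] vershik_at_first_nonmax(3)[OF assms(1)]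
  by (meson less_le_trans)

text \<open>
  The carry stops inside a prefix that contains a non-maximal edge, so nothing beyond it matters.\<close>

lemma vershik_determined_by_prefix:
  assumes x: "x \<in> X" and y: "y \<in> X" and ag: "agree k x y" and nm: "\<not> all_max k x"
  shows "agree k (T x) (T y)"
proof -
  obtain j where j: "j < k" "all_max j x" "x j \<notin> max_edges B" using first_failure[OF nm] by blast
  then have jy: "all_max j y" "y j \<notin> max_edges B" "x j = y j" using ag by auto
  note X = vershik_at_first_nonmax[OF x j(2,3)] and Y = vershik_at_first_nonmax[OF y jy(1,2)]
  have e: "T x j = T y j" using X(2) Y(2) jy(3) is_succ_unique by metis
  then have "agree j (T x) (T y)" using min_prefix_unique[OF X(1) Y(1) X(4) Y(4)] by simp
  then show ?thesis using e X(3) Y(3) ag by (metis nat_neq_iff)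
qed

text \<open>
  Run the odometer backwards: the first non-minimal edge of \<open>y\<close> is replaced by its predecessor and
  everything before it by the maximal path to the source of that predecessor.\<close>

lemma vershik_surj:
  assumes y: "y \<in> X" shows "\<exists>x\<in>X. T x = y"
proof (cases "y = x_min B")
  case True
  then show ?thesis using vershik_x_max x_max_in by blast
next
  case False
  then obtain n where "y n \<notin> min_edges B" using x_min_unique y by blast
  then obtain j where j: "all_min j y" "y j \<notin> min_edges B"
    using first_failure[of "Suc n" y "min_edges B"] by blast
  obtain g where g: "g \<in> all_edges B" "is_succ g (y j)"
    using is_succ_pred_exists[OF X_all_edges[OF y] j(2)] by blast
  then have rg: "r g = r (y j)" by (simp add: is_succ_def)
  then have "g \<in> E (Suc j)" using g edge_level rng_in[OF X_edge[OF y]] by simp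
  then obtain p where p: "p @ [g] \<in> paths B 0 (Suc j)" "set p \<subseteq> max_edges B"
    using max_path_exists by blast
  then have len: "length p = j" by (simp add: paths_def)
  define x where "x = (\<lambda>n. if n < Suc j then (p @ [g]) ! n else y n)"
  have "r ((p @ [g]) ! j) = s (y (Suc j))"
    using len rg X_link[OF y, of j] by (simp add: nth_append)
  then have x: "x \<in> X" unfolding x_def by (rule splice_initial[OF y p(1)])
  have xj: "x j = g" and xmax: "all_max j x" and xn: "\<And>n. j < n \<Longrightarrow> x n = y n"
    using len p(2) by (auto simp: x_def nth_append)
  have "x j \<notin> max_edges B" using is_succ_not_max g xj by simp
  note X = vershik_at_first_nonmax[OF x xmax this]
  have e: "T x j = y j" using X(2) g xj is_succ_unique by metis
  then have "agree j (T x) y" using min_prefix_unique[OF X(1) y X(4) j(1)] by simp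
  then have "T x n = y n" for n using e X(3) xn by (metis nat_neq_iff)
  then show ?thesis using x by blast
qed

lemma vershik_ne_x_min:
  assumes "x \<in> X" "x \<noteq> x_max B" shows "T x \<noteq> x_min B"
proof -
  obtain j where "all_max j x" "x j \<notin> max_edges B" using not_x_max_imp_nonmax assms by blast
  then have "T x j \<notin> min_edges B"
    using vershik_at_first_nonmax(2)[OF assms(1)] is_succ_not_min[OF X_all_edges[OF assms(1)]] by blast
  then show ?thesis using x_min_in by metis
qed

text \<open>
  For a non-maximal \<open>x\<close> the first non-minimal edge of \<open>T x\<close> sits where the first non-maximal edge
  of \<open>x\<close> sits, so \<open>x\<close> can be reconstructed from \<open>T x\<close>.\<close>

lemma vershik_inj:
  assumes x: "x \<in> X" and y: "y \<in> X" and eq: "T x = T y" shows "x = y"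
proof (cases "x = x_max B \<or> y = x_max B")
  case True
  then show ?thesis using vershik_ne_x_min vershik_x_max assms by metis
next
  case False
  obtain j where j: "all_max j x" "x j \<notin> max_edges B" using not_x_max_imp_nonmax x False by blast
  obtain i where i: "all_max i y" "y i \<notin> max_edges B" using not_x_max_imp_nonmax y False by blast
  note X = vershik_at_first_nonmax[OF x j] and Y = vershik_at_first_nonmax[OF y i]
  have "T x j \<notin> min_edges B" "T y i \<notin> min_edges B"
    using X(2) Y(2) is_succ_not_min X_all_edges x y by blast+
  then have ij: "i = j" using X(4) Y(4) eq by (metis nat_neq_iff)
  then have e: "x j = y j" using X(2) Y(2) eq is_succ_inj X_all_edges x y by metis
  then have "agree j x y" using max_prefix_unique[OF x y j(1)] i(1) ij by simp
  moreover have "x n = y n" if "j < n" for n using X(3) Y(3) eq ij that by metis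
  ultimately show ?thesis using e by (metis nat_neq_iff ext)
qed

lemma vershik_bij: "bij_betw T X X"
  unfolding bij_betw_def inj_on_def using vershik_in vershik_inj vershik_surj
  by (auto simp: image_iff) metis

text \<open>
  Continuity at the maximal path rests on this: paths with longer and longer minimal prefixes that
  stay away from the minimal path would accumulate at a second path consisting of minimal edges.\<close>

lemma min_prefix_converges_to_x_min: "\<exists>k. \<forall>z\<in>X. all_min k z \<longrightarrow> agree m z (x_min B)"
proof (rule ccontr)
  assume "\<nexists>k. \<forall>z\<in>X. all_min k z \<longrightarrow> agree m z (x_min B)"
  then obtain Z where Z: "\<And>k. Z k \<in> X" "\<And>k. all_min k (Z k)" "\<And>k. \<not> agree m (Z k) (x_min B)"
    by metis
  obtain x where "\<And>l. infinite {k. agree l (Z k) x}"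
    using limit_point_of_finite_branching[of "\<lambda>n. E (Suc n)" Z] finite_E X_edge[OF Z(1)] by blast
  then have inf: "infinite {k. agree l (Z k) x}" for l by blast
  have x: "\<exists>k>l. agree l (Z k) x" for l
  proof (rule ccontr)
    assume "\<not> (\<exists>k>l. agree l (Z k) x)"
    then have "{k. agree l (Z k) x} \<subseteq> {..l}" by (auto simp: not_less[symmetric])
    then show False using inf[of l] finite_subset finite_atMost by blast
  qed
  have path: "x n \<in> E (Suc n) \<and> r (x n) = s (x (Suc n)) \<and> x n \<in> min_edges B" for n
  proof -
    obtain k where k: "k > n + 2" "agree (n + 2) (Z k) x" using x by blast
    have "Z k n = x n" "Z k (Suc n) = x (Suc n)" "Z k n \<in> min_edges B"
      using k(2)[rule_format, of n] k(2)[rule_format, of "Suc n"] k(1) Z(2)[of k, rule_format, of n] by simp_all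
    then show ?thesis
      using X_edge[OF Z(1), of k n] X_link[OF Z(1), of k n] by simp
  qed
  have "x \<in> X" unfolding path_space_def using path by blast
  moreover have "\<forall>n. x n \<in> min_edges B" using path by blast
  ultimately have "x = x_min B" by (rule x_min_unique)
  then show False using x[of m] Z(3) by blast
qed

text \<open>
  Away from the maximal path a prefix with a non-maximal edge decides the prefix of the image. A path
  that agrees with the maximal one for long is sent to a path with a long minimal prefix.\<close>

lemma vershik_continuous:
  assumes x: "x \<in> X" shows "\<exists>k. \<forall>y\<in>X. agree k y x \<longrightarrow> agree m (T y) (T x)"
proof (cases "x = x_max B")
  case True
  obtain k where k: "\<forall>z\<in>X. all_min k z \<longrightarrow> agree m z (x_min B)"
    using min_prefix_converges_to_x_min by blast
  have "agree m (T y) (T x)" if "y \<in> X" "agree k y x" for y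
  proof -
    have "all_max k y" using that(2) True x_max_in by simp
    then show ?thesis using k that vershik_in vershik_all_max_imp_all_min True vershik_x_max by metis
  qed
  then show ?thesis by blast
next
  case False
  then obtain j where j: "x j \<notin> max_edges B" using not_x_max_imp_nonmax x by blast
  have "agree m (T y) (T x)" if "y \<in> X" "agree (max m (Suc j)) y x" for y
    using vershik_determined_by_prefix[OF that(1) x that(2)] j that(2) by force
  then show ?thesis by blast
qed

lemma vershik_funpow_in: "x \<in> X \<Longrightarrow> (T ^^ t) x \<in> X"
  by (induction t) (auto simp: vershik_in)

lemma vershik_funpow_continuous:
  assumes x: "x \<in> X" shows "\<exists>k. \<forall>y\<in>X. agree k y x \<longrightarrow> agree m ((T ^^ t) y) ((T ^^ t) x)"
proof (induction t arbitrary: m)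
  case 0
  then show ?case by auto
next
  case (Suc t)
  obtain k where k: "\<forall>y\<in>X. agree k y ((T ^^ t) x) \<longrightarrow> agree m (T y) (T ((T ^^ t) x))"
    using vershik_continuous vershik_funpow_in x by blast
  obtain k' where "\<forall>y\<in>X. agree k' y x \<longrightarrow> agree k ((T ^^ t) y) ((T ^^ t) x)"
    using Suc by blast
  then show ?case using k vershik_funpow_in by (intro exI[of _ k']) simp
qed

lemma vershik_window_continuous:
  assumes x: "x \<in> X"
  shows "\<exists>k. \<forall>y\<in>X. agree k y x \<longrightarrow> (\<forall>t\<le>l. agree m ((T ^^ t) y) ((T ^^ t) x))"
proof (induction l)
  case 0
  then show ?case by auto
next
  case (Suc l)
  then obtain k where k: "\<forall>y\<in>X. agree k y x \<longrightarrow> (\<forall>t\<le>l. agree m ((T ^^ t) y) ((T ^^ t) x))"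
    by blast
  obtain k' where k': "\<forall>y\<in>X. agree k' y x \<longrightarrow> agree m ((T ^^ Suc l) y) ((T ^^ Suc l) x)"
    using vershik_funpow_continuous[OF x] by blast
  have "agree m ((T ^^ t) y) ((T ^^ t) x)" 
    if "y \<in> X" "agree (max k k') y x" "t \<le> Suc l" for y t
  proof -
    have "agree k y x" "agree k' y x" using that by auto
    then show ?thesis using k k' that le_Suc_eq by metis
  qed
  then show ?case by blast
qed

section \<open>Minimal and maximal prefixes along an orbit\<close>

definition edge_rank :: "'e \<Rightarrow> nat" where
  "edge_rank e = card {g \<in> all_edges B. (g, e) \<in> edge_order B \<and> g \<noteq> e}"

lemma edge_rank_less_card:
  assumes "e \<in> E (Suc n)" shows "edge_rank e < card (E (Suc n))"
proof -
  have e: "e \<in> all_edges B" using assms all_edges_iff by blast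
  have "g \<in> E (Suc n)" if "g \<in> all_edges B" "(g, e) \<in> edge_order B" for g
    using comparable_iff[OF that(1) e] that edge_level[OF that(1)] rng_in[OF assms] by simp
  then have "{g \<in> all_edges B. (g, e) \<in> edge_order B \<and> g \<noteq> e} \<subset> E (Suc n)"
    using assms by blast
  then show ?thesis unfolding edge_rank_def by (rule psubset_card_mono[OF finite_E])
qed

lemma edge_rank_succ:
  assumes e: "e \<in> all_edges B" and ef: "is_succ e f" shows "edge_rank e < edge_rank f"
proof -
  have f: "f \<in> all_edges B" "(e, f) \<in> edge_order B" "f \<noteq> e" using ef by (auto simp: is_succ_def)
  have "finite {g \<in> all_edges B. (g, f) \<in> edge_order B \<and> g \<noteq> f}"
  proof (rule finite_subset[OF _ finite_fibre[OF f(1)]])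
    show "{g \<in> all_edges B. (g, f) \<in> edge_order B \<and> g \<noteq> f} \<subseteq> {g \<in> all_edges B. r g = r f}"
      using comparable_iff f(1) by blast
  qed
  moreover have "{g \<in> all_edges B. (g, e) \<in> edge_order B \<and> g \<noteq> e} \<subset>
      {g \<in> all_edges B. (g, f) \<in> edge_order B \<and> g \<noteq> f}"
    using f e transD[OF edge_order_trans] antisymD[OF edge_order_antisym] by blast
  ultimately show ?thesis unfolding edge_rank_def by (rule psubset_card_mono)
qed

text \<open>
  The initial segments of length \<open>k\<close> are numbered as in a mixed-radix system, the edge of level
  \<open>n\<close> being a digit below the number of edges of that level. Applying the map
  resets leading maximal digits and increases the first digit that is not maximal. The digits that
  are reset are less significant, so the number goes up. This
  bounds the time until all \<open>k\<close> edges are maximal, and likewise backwards.\<close>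

fun prefix_bound :: "nat \<Rightarrow> nat" where
  "prefix_bound 0 = 1"
| "prefix_bound (Suc k) = prefix_bound k * card (E (Suc k))"

fun prefix_rank :: "nat \<Rightarrow> (nat \<Rightarrow> 'e) \<Rightarrow> nat" where
  "prefix_rank 0 x = 0"
| "prefix_rank (Suc k) x = prefix_rank k x + prefix_bound k * edge_rank (x k)"

lemma prefix_rank_less: "x \<in> X \<Longrightarrow> prefix_rank k x < prefix_bound k"
proof (induction k)
  case (Suc k)
  have "prefix_rank k x + prefix_bound k * edge_rank (x k) < prefix_bound k * Suc (edge_rank (x k))"
    using Suc by simp
  also have "\<dots> \<le> prefix_bound k * card (E (Suc k))"
    using edge_rank_less_card[OF X_edge[OF Suc.prems, of k]] by (intro mult_le_mono2) simp
  finally show ?case by simp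
qed simp

lemma prefix_rank_increases:
  assumes x: "x \<in> X"
  shows "\<not> all_max k x \<Longrightarrow> prefix_rank k x < prefix_rank k (T x)"
proof (induction k)
  case (Suc k)
  show ?case
  proof (cases "all_max k x")
    case True
    then have nm: "x k \<notin> max_edges B" using Suc.prems by (auto simp: less_Suc_eq)
    have "edge_rank (x k) < edge_rank (T x k)"
      by (rule edge_rank_succ[OF X_all_edges[OF x] vershik_at_first_nonmax(2)[OF x True nm]])
    then have "prefix_bound k * Suc (edge_rank (x k)) \<le> prefix_bound k * edge_rank (T x k)"
      by (intro mult_le_mono2) simp
    then show ?thesis using prefix_rank_less[OF x, of k] by simp
  next
    case False
    then show ?thesis using Suc.IH vershik_not_all_max[OF x False, of k] by simp
  qed
qed simp

text \<open>
  The last cut at or before the present. Between cuts all \<open>k\<close> edges are never simultaneously maximal,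
  since this would produce another cut one step later.\<close>

lemma all_min_prefix_before:
  assumes "x \<in> X"
  shows "\<exists>z\<in>X. \<exists>n\<le>prefix_rank k x. all_min k z \<and> (T ^^ n) z = x \<and> (\<forall>t<n. \<not> all_max k ((T ^^ t) z))"
  using assms
proof (induction "prefix_rank k x" arbitrary: x rule: less_induct)
  case less
  show ?case
  proof (cases "all_min k x")
    case True
    then show ?thesis using less.prems by (intro bexI[of _ x] exI[of _ 0]) auto
  next
    case False
    obtain y where y: "y \<in> X" "T y = x" using vershik_surj less.prems by blast
    have nm: "\<not> all_max k y" using vershik_all_max_imp_all_min[OF y(1)] y(2) False by blast
    then have lt: "prefix_rank k y < prefix_rank k x" using prefix_rank_increases y by blast
    obtain z n where z: "z \<in> X" "n \<le> prefix_rank k y" "all_min k z" "(T ^^ n) z = y"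
      "\<forall>t<n. \<not> all_max k ((T ^^ t) z)"
      using less.hyps[OF lt y(1)] by blast
    have "\<forall>t<Suc n. \<not> all_max k ((T ^^ t) z)" using z(4,5) nm by (metis less_Suc_eq)
    moreover have "(T ^^ Suc n) z = x" "Suc n \<le> prefix_rank k x" using z lt y(2) by auto
    ultimately show ?thesis using z(1,3) by blast
  qed
qed

lemma all_max_prefix_after:
  assumes x: "x \<in> X" shows "\<exists>n\<le>prefix_bound k. all_max k ((T ^^ n) x)"
proof (rule ccontr)
  assume "\<not> ?thesis"
  then have nm: "\<not> all_max k ((T ^^ n) x)" if "n \<le> prefix_bound k" for n using that by blast
  have "n \<le> prefix_rank k ((T ^^ n) x)" if "n \<le> prefix_bound k" for n
    using that
  proof (induction n)
    case (Suc n)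
    have "n \<le> prefix_rank k ((T ^^ n) x)" using Suc by simp
    also have "\<dots> < prefix_rank k (T ((T ^^ n) x))"
      by (rule prefix_rank_increases[OF vershik_funpow_in[OF x] nm]) (use Suc.prems in simp)
    finally show ?case by simp
  qed simp
  from this[of "prefix_bound k"] show False
    using prefix_rank_less[OF vershik_funpow_in[OF x, of "prefix_bound k"], of k] by simp
qed

text \<open>
  Started at a cut, this says that the prefixes seen throughout a tile depend only on its first one.\<close>

lemma funpow_determined_by_prefix:
  assumes x: "x \<in> X" and y: "y \<in> X" and ag: "agree k x y"
    and nm: "\<forall>t<n. \<not> all_max k ((T ^^ t) x)" and "t \<le> n"
  shows "agree k ((T ^^ t) x) ((T ^^ t) y)"
  using assms(5)
proof (induction t)
  case (Suc t)
  have "t < n" using Suc.prems by simp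
  have 1: "agree k ((T ^^ t) x) ((T ^^ t) y)" by (rule Suc.IH[OF less_imp_le[OF \<open>t < n\<close>]])
  have 2: "\<not> all_max k ((T ^^ t) x)" by (rule nm[rule_format, OF \<open>t < n\<close>])
  from vershik_determined_by_prefix[OF vershik_funpow_in[OF x] vershik_funpow_in[OF y] 1 2]
  show ?case by simp
qed (use ag in simp)

lemma funpow_preserves_tail:
  assumes x: "x \<in> X" and "\<forall>t<n. \<not> all_max k ((T ^^ t) x)" and "k \<le> m"
  shows "(T ^^ n) x m = x m"
  using assms(2)
proof (induction n)
  case (Suc n)
  then have "\<not> all_max k ((T ^^ n) x)" by blast
  then have "T ((T ^^ n) x) m = (T ^^ n) x m"
    by (rule vershik_not_all_max[OF vershik_funpow_in[OF x] _ assms(3)])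
  moreover have "(T ^^ n) x m = x m" by (rule Suc.IH) (use Suc.prems less_SucI in blast)
  ultimately show ?case by simp
qed simp

section \<open>Uniform recurrence\<close>

text \<open>
  The levels of a fully connected telescoping provide the pair \<open>k'\<close> and \<open>l\<close>. Moving up to
  \<open>k'\<close> costs nothing: it only means that longer prefixes are to be matched.\<close>

lemma connected_levels:
  "\<exists>k'\<ge>k. \<exists>l>k'. \<forall>u\<in>V k'. \<forall>v\<in>V l. \<exists>c\<in>paths B k' l. s (c ! 0) = u \<and> r (c ! (l - k' - 1)) = v"
proof -
  obtain m where m: "strict_mono m" "fully_connected (telescope B m)"
    using simple by (auto simp: simple_diagram_def)
  have lt: "m k < m (Suc k)" using m(1) by (simp add: strict_mono_Suc_iff)
  have "\<exists>c\<in>paths B (m k) (m (Suc k)). s (c ! 0) = u \<and> r (c ! (m (Suc k) - m k - 1)) = v"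
    if uv: "u \<in> V (m k)" "v \<in> V (m (Suc k))" for u v
  proof -
    have "\<forall>u\<in>V (m k). \<forall>v\<in>V (m (Suc k)). \<exists>c\<in>paths B (m k) (m (Suc k)). s (hd c) = u \<and> r (last c) = v"
      using m(2)[unfolded fully_connected_def, rule_format, of "Suc k"]
      by (simp add: telescope_def)
    then obtain c where c: "c \<in> paths B (m k) (m (Suc k))" "s (hd c) = u" "r (last c) = v"
      using uv by blast
    then have "length c = m (Suc k) - m k" "c \<noteq> []" using lt by (auto simp: paths_def)
    then show ?thesis using c by (auto simp: hd_conv_nth last_conv_nth)
  qed
  then show ?thesis using lt strict_mono_imp_increasing[OF m(1), of k] by blast
qed

text \<open>
  Wait for a point \<open>y'\<close> of the orbit of \<open>y\<close> that has a minimal prefix of length \<open>l\<close>. Let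
  \<open>z\<close> be the path that starts like \<open>x\<close> and is then led into the tail of \<open>y'\<close> at level \<open>l\<close>.
  Going back from \<open>z\<close> to its last cut at level \<open>l\<close> does not change this tail, and there is only one
  minimal path to the vertex where it begins, so that cut is \<open>y'\<close>. Hence \<open>z\<close> is in the
  forward orbit of \<open>y\<close>.\<close>

lemma uniformly_recurrent:
  assumes x: "x \<in> X" shows "\<exists>R. \<forall>y\<in>X. \<exists>n\<le>R. agree k ((T ^^ n) y) x"
proof -
  obtain k' l where kl: "k \<le> k'" "k' < l"
    and conn: "\<forall>u\<in>V k'. \<forall>v\<in>V l. \<exists>c\<in>paths B k' l. s (c ! 0) = u \<and> r (c ! (l - k' - 1)) = v"
    using connected_levels by blast
  \<comment> \<open>At most \<open>prefix_bound l\<close> steps to a maximal prefix, one more to the cut \<open>y'\<close>, and fewer than \<open>prefix_bound l\<close> on to \<open>z\<close>.\<close>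
  have "\<exists>n\<le>2 * prefix_bound l + 1. agree k ((T ^^ n) y) x" if y: "y \<in> X" for y
  proof -
    obtain a where a: "a \<le> prefix_bound l" "all_max l ((T ^^ a) y)"
      using all_max_prefix_after[OF y] by blast
    define y' where "y' = (T ^^ Suc a) y"
    have y': "y' \<in> X" unfolding y'_def by (rule vershik_funpow_in[OF y])
    have min': "all_min l y'" unfolding y'_def
      using vershik_all_max_imp_all_min[OF vershik_funpow_in[OF y] a(2)] by simp
    have "s (x k') \<in> V k'" "s (y' l) \<in> V l" using src_in X_edge x y' by blast+
    then obtain c where c: "c \<in> paths B k' l" "s (c ! 0) = s (x k')" "r (c ! (l - k' - 1)) = s (y' l)"
      using conn by blast
    define z where "z = (\<lambda>n. if n < k' then x n else if n < l then c ! (n - k') else y' n)"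
    have z: "z \<in> X" unfolding z_def by (rule splice[OF x y' c(1) kl(2) c(2,3)])
    obtain z' b where z': "z' \<in> X" "b \<le> prefix_rank l z" "all_min l z'" "(T ^^ b) z' = z"
      "\<forall>t<b. \<not> all_max l ((T ^^ t) z')"
      using all_min_prefix_before[OF z] by blast
    have tail: "z' n = y' n" if "l \<le> n" for n
      using funpow_preserves_tail[OF z'(1,5) that] that kl z'(4) by (simp add: z_def)
    have "agree l z' y'"
      by (rule min_prefix_unique[OF z'(1) y' z'(3) min']) (simp add: tail)
    then have "z' = y'" using tail by (metis ext not_less)
    then have "(T ^^ (b + Suc a)) y = z" using z'(4) unfolding y'_def funpow_add comp_apply by blast
    moreover have "b + Suc a \<le> 2 * prefix_bound l + 1"
      using a(1) z'(2) prefix_rank_less[OF z, of l] by simp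
    moreover have "agree k z x" using kl by (simp add: z_def)
    ultimately show ?thesis by metis
  qed
  then show ?thesis by blast
qed

section \<open>Points without common cuts force squares\<close>

abbreviation "iter \<equiv> vershik_iterate B"

lemmas iter_in = int_iterate_in[OF vershik_bij]
lemmas iter_add = int_iterate_add[OF vershik_bij]

lemma iter_add_nat: "x \<in> X \<Longrightarrow> iter (m + int t) x = (T ^^ t) (iter m x)"
  using iter_add[of x "int t" m] by (simp add: int_iterate_of_nat add.commute)

lemma trunc_eq_iff: "trunc k x = trunc k y \<longleftrightarrow> agree k x y"
  by (auto simp: trunc_def)

lemma trunc_min_iff: "set (trunc k x) \<subseteq> min_edges B \<longleftrightarrow> all_min k x"
  by (auto simp: trunc_def)

lemma last_cut:
  assumes y: "y \<in> X"
  shows "\<exists>a\<le>prefix_bound j. all_min j (iter (n - int a) y) \<and>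
    (\<forall>t<a. \<not> all_max j ((T ^^ t) (iter (n - int a) y)))"
proof -
  obtain z a where z: "z \<in> X" "a \<le> prefix_rank j (iter n y)" "all_min j z" "(T ^^ a) z = iter n y"
      "\<forall>t<a. \<not> all_max j ((T ^^ t) z)"
    using all_min_prefix_before[OF iter_in[OF y]] by blast
  have "iter (n - int a) y = iter (- int a) (iter n y)" using iter_add[OF y, of "- int a" n] by simp
  also have "\<dots> = iter (- int a) (iter (int a) z)" using z(4) by (simp add: int_iterate_of_nat)
  also have "\<dots> = z" using iter_add[OF z(1), of "- int a" "int a"] by simp
  finally have "iter (n - int a) y = z" .
  then show ?thesis using z prefix_rank_less[OF iter_in[OF y], of j n] by (intro exI[of _ a]) simp
qed

text \<open>
  The tile of \<open>y\<close> that contains the time \<open>n\<close> starts at \<open>n - a y\<close>, and its type is the vertex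
  \<open>f y\<close>. Two points of equal type with \<open>a y2 < a y1\<close> run through the same prefixes
  from \<open>n - a y1\<close> and \<open>n - a y2\<close> on, until \<open>y1\<close> reaches the time \<open>n\<close>.
  Therefore \<open>w\<close> repeats itself with shift \<open>d = a y1 - a y2\<close> on all of \<open>n - a y1, \<dots>, n\<close>,
  and the \<open>d\<close> positions before \<open>n\<close> are among these.\<close>

lemma square_at_every_position:
  assumes Y: "Y \<subseteq> X" and card: "card (V j) < card Y" and ij: "i \<le> j"
    and nocut: "pairwise (\<lambda>x x'. \<not> common_cut B j x x') Y"
    and w: "\<And>y. y \<in> Y \<Longrightarrow> factor_map B i y = w"
  shows "\<exists>d\<ge>1. d \<le> prefix_bound j \<and> (\<forall>m. n - int d \<le> m \<and> m < n \<longrightarrow> w m = w (m + int d))"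
proof -
  have "\<forall>y\<in>Y. \<exists>a. a \<le> prefix_bound j \<and> all_min j (iter (n - int a) y) \<and>
      (\<forall>t<a. \<not> all_max j ((T ^^ t) (iter (n - int a) y)))"
    using last_cut Y by blast
  then obtain a where a: "\<And>y. y \<in> Y \<Longrightarrow> a y \<le> prefix_bound j"
    and min: "\<And>y. y \<in> Y \<Longrightarrow> all_min j (iter (n - int (a y)) y)"
    and nm: "\<And>y. y \<in> Y \<Longrightarrow> \<forall>t<a y. \<not> all_max j ((T ^^ t) (iter (n - int (a y)) y))"
    using bchoice[of Y] by metis
  define f where "f y = s (iter (n - int (a y)) y j)" for y
  have "f ` Y \<subseteq> V j" unfolding f_def using src_in X_edge iter_in Y by blast
  then have "card (f ` Y) < card Y" using card card_mono[OF finite_V] by (meson le_less_trans)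
  then obtain y1 y2 where y12: "y1 \<in> Y" "y2 \<in> Y" "y1 \<noteq> y2" "f y1 = f y2"
    using pigeonhole[of f Y] by (auto simp: inj_on_def)
  have key: ?thesis if y: "y1 \<in> Y" "y2 \<in> Y" "f y1 = f y2" and lt: "a y2 < a y1" for y1 y2
  proof -
    have X: "y1 \<in> X" "y2 \<in> X" using y Y by auto
    let ?u1 = "iter (n - int (a y1)) y1" and ?u2 = "iter (n - int (a y2)) y2"
    have "agree j ?u1 ?u2"
      by (rule min_prefix_unique) (use iter_in X min y f_def in auto)
    then have ag: "agree j ((T ^^ t) ?u1) ((T ^^ t) ?u2)" if "t \<le> a y1" for t
      using funpow_determined_by_prefix[OF iter_in[OF X(1)] iter_in[OF X(2)] _ nm[OF y(1)] that] by blast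
    have eq: "w (n - int (a y1) + int t) = w (n - int (a y2) + int t)" if "t \<le> a y1" for t
    proof -
      have "agree i (iter (n - int (a y1) + int t) y1) (iter (n - int (a y2) + int t) y2)"
        using ag[OF that] ij iter_add_nat X by simp
      then have "factor_map B i y1 (n - int (a y1) + int t) = factor_map B i y2 (n - int (a y2) + int t)"
        unfolding factor_map_def trunc_eq_iff .
      then show ?thesis using w y by simp
    qed
    define d where "d = a y1 - a y2"
    have "w m = w (m + int d)" if m: "n - int d \<le> m" "m < n" for m
    proof -
      define t where "t = nat (m - (n - int (a y1)))"
      have "int t = m - (n - int (a y1))" using m lt by (simp add: t_def d_def)
      moreover from this have "t \<le> a y1" using m by simp
      moreover have "int d = int (a y1) - int (a y2)" using lt by (simp add: d_def)
      ultimately have "t \<le> a y1" "n - int (a y1) + int t = m" "n - int (a y2) + int t = m + int d"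
        by simp_all
      then show ?thesis using eq[of t] by simp
    qed
    moreover have "1 \<le> d" "d \<le> prefix_bound j" using lt a[OF y(1)] by (auto simp: d_def)
    ultimately show ?thesis by blast
  qed
  have "a y1 \<noteq> a y2"
  proof
    assume "a y1 = a y2"
    then have "common_cut B j y1 y2"
      unfolding common_cut_def trunc_min_iff using min[OF y12(1)] min[OF y12(2)] by auto
    then show False using nocut y12 by (auto simp: pairwise_def)
  qed
  then consider "a y1 < a y2" | "a y2 < a y1" by linarith
  then show ?thesis using key[of y1 y2] key[of y2 y1] y12 by cases auto
qed

section \<open>From periodic windows to a periodic subshift\<close>

lemma factor_map_shift: "x \<in> X \<Longrightarrow> factor_map B i (iter n x) = (\<lambda>m. factor_map B i x (m + n))"
  by (simp add: factor_map_def iter_add)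

text \<open>
  Integer iterates of the shift use \<^const>\<open>inv_into\<close> on the subshift, so they are the expected
  translations only once the shift is known to be a bijection of it.\<close>

lemma left_shift_bij_factor_space: "bij_betw left_shift (factor_space B i) (factor_space B i)"
proof -
  have sh: "left_shift (factor_map B i x) = factor_map B i (T x)" if "x \<in> X" for x
    using factor_map_shift[OF that, of i 1] int_iterate_of_nat[of X T 1 x]
    by (simp add: left_shift_def)
  have "left_shift ` factor_space B i = factor_map B i ` T ` X"
    unfolding factor_space_def image_image by (rule image_cong) (simp_all add: sh)
  also have "\<dots> = factor_space B i"
    using bij_betw_imp_surj_on[OF vershik_bij] by (simp add: factor_space_def)
  finally have "left_shift ` factor_space B i = factor_space B i" .
  moreover have "inj (left_shift :: (int \<Rightarrow> 'e list) \<Rightarrow> _)"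
  proof (rule injI, rule ext)
    fix u v :: "int \<Rightarrow> 'e list" and m assume "left_shift u = left_shift v"
    then have "left_shift u (m - 1) = left_shift v (m - 1)" by simp
    then show "u m = v m" by (simp add: left_shift_def)
  qed
  ultimately show ?thesis by (auto simp: bij_betw_def intro: inj_on_subset)
qed

text \<open>
  By continuity the coordinates \<open>0, \<dots>, p\<close> of the image of \<open>x\<close> are visible in a prefix of
  \<open>x\<close>, and this prefix recurs in the orbit of \<open>y\<close> within some \<open>R\<close> steps. A periodic window
  longer than \<open>R\<close> catches such a recurrence, so the coordinates \<open>0\<close> and \<open>p\<close> agree;
  for the iterates of \<open>x\<close> in place of \<open>x\<close> this is \<open>p\<close>-periodicity of its image. Once this is known, any recurrence shows the image of \<open>x\<close> to be a shift of the image of \<open>y\<close>, and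
  shifts by \<open>n\<close> and \<open>n mod p\<close> coincide.\<close>

lemma long_periodic_windows_imp_periodic_subshift:
  assumes y: "y \<in> X" and p: "p > 0"
    and win: "\<And>l. \<exists>q. \<forall>t<l. factor_map B i y (q + int t) = factor_map B i y (q + int t + int p)"
  shows "periodic_subshift (factor_space B i)"
proof -
  define w where "w = factor_map B i y"
  have T_p: "agree i ((T ^^ p) x) x" if x: "x \<in> X" for x
  proof -
    obtain k where k: "\<forall>z\<in>X. agree k z x \<longrightarrow> (\<forall>t\<le>p. agree i ((T ^^ t) z) ((T ^^ t) x))"
      using vershik_window_continuous[OF x] by blast
    obtain R where R: "\<forall>z\<in>X. \<exists>n\<le>R. agree k ((T ^^ n) z) x" using uniformly_recurrent[OF x] by blast
    obtain q where q: "\<forall>t<Suc R. w (q + int t) = w (q + int t + int p)" using win w_def by blast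
    obtain n where n: "n \<le> R" "agree k ((T ^^ n) (iter q y)) x" using R iter_in[OF y] by blast
    let ?z = "iter (q + int n) y"
    have z: "?z \<in> X" "agree k ?z x" using iter_in[OF y, of "q + int n"] n(2) iter_add_nat[OF y, of q n] by simp_all
    have "w (q + int n) = w (q + int n + int p)" using q n(1) by simp
    then have "agree i ?z ((T ^^ p) ?z)"
      unfolding w_def factor_map_def trunc_eq_iff using iter_add_nat[OF y, of "q + int n" p] by simp
    moreover have "agree i ((T ^^ 0) ?z) ((T ^^ 0) x)" "agree i ((T ^^ p) ?z) ((T ^^ p) x)"
      using k z by blast+
    ultimately show ?thesis by simp
  qed
  have per: "factor_map B i x (m + int p) = factor_map B i x m" if "x \<in> X" for x m
    unfolding factor_map_def trunc_eq_iff using T_p[OF iter_in[OF that]] iter_add_nat[OF that] by simp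
  \<comment> \<open>Two \<open>p\<close>-periodic words are equal if they agree on the first \<open>p\<close> coordinates.\<close>
  have orbit: "\<exists>n::int. factor_map B i x = (\<lambda>m. w (m + n))" if x: "x \<in> X" for x
  proof -
    obtain k where k: "\<forall>z\<in>X. agree k z x \<longrightarrow> (\<forall>t\<le>p. agree i ((T ^^ t) z) ((T ^^ t) x))"
      using vershik_window_continuous[OF x] by blast
    obtain n where n: "agree k ((T ^^ n) y) x" using uniformly_recurrent[OF x] y by blast
    let ?z = "iter (int n) y"
    have z: "?z \<in> X" "agree k ?z x" using iter_in[OF y, of "int n"] n by (simp_all add: int_iterate_of_nat)
    have "factor_map B i x m = factor_map B i ?z m" for m
    proof -
      define t where "t = nat (m mod int p)"
      have t: "int t = m mod int p" "t \<le> p" using p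
        by (auto simp: t_def pos_mod_bound less_imp_le nat_le_iff)
      have "agree i ((T ^^ t) ?z) ((T ^^ t) x)" using k z t by blast
      then have "factor_map B i x (int t) = factor_map B i ?z (int t)"
        unfolding factor_map_def trunc_eq_iff by (simp add: int_iterate_of_nat)
      then show ?thesis
        using int_periodic_mod[of "factor_map B i x" "int p" m, OF per[OF x]]
          int_periodic_mod[of "factor_map B i ?z" "int p" m, OF per[OF z(1)]] t(1) by simp
    qed
    then show ?thesis using factor_map_shift[OF y, of i "int n"] w_def by auto
  qed
  have w: "w \<in> factor_space B i" using y by (simp add: w_def factor_space_def)
  note shift = int_iterate_left_shift[OF left_shift_bij_factor_space w]
  have "factor_space B i = range (\<lambda>n. int_iterate (factor_space B i) left_shift n w)"
  proof
    show "factor_space B i \<subseteq> range (\<lambda>n. int_iterate (factor_space B i) left_shift n w)"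
    proof
      fix u assume "u \<in> factor_space B i"
      then obtain n where "u = (\<lambda>m. w (m + n))" using orbit by (auto simp: factor_space_def)
      then show "u \<in> range (\<lambda>n. int_iterate (factor_space B i) left_shift n w)"
        using shift[of n] by (metis rangeI)
    qed
    show "range (\<lambda>n. int_iterate (factor_space B i) left_shift n w) \<subseteq> factor_space B i"
      using int_iterate_in[OF left_shift_bij_factor_space w] by blast
  qed
  moreover have "finite (factor_space B i)"
  proof (rule finite_subset)
    show "factor_space B i \<subseteq> (\<lambda>n m. w (m + n)) ` {0..<int p}"
    proof
      fix u assume "u \<in> factor_space B i"
      then obtain n where n: "u = (\<lambda>m. w (m + n))" using orbit by (auto simp: factor_space_def)
      have wp: "w (m mod int p) = w m" for m
        using int_periodic_mod[of w "int p"] per[OF y] w_def by simp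
      have "w (m + n) = w (m + n mod int p)" for m
        using wp[of "m + n"] wp[of "m + n mod int p"] by (simp add: mod_add_right_eq)
      then have "u = (\<lambda>m. w (m + n mod int p))" using n by simp
      then show "u \<in> (\<lambda>n m. w (m + n)) ` {0..<int p}" using p by auto
    qed
  qed simp
  ultimately show ?thesis using w unfolding periodic_subshift_def by blast
qed

lemma finite_range_factor_map:
  assumes "x \<in> X" shows "finite (range (factor_map B i x))"
proof (rule finite_subset)
  show "range (factor_map B i x) \<subseteq> {es. set es \<subseteq> (\<Union>n<i. E (Suc n)) \<and> length es = i}"
    using X_edge[OF iter_in[OF assms]] by (fastforce simp: factor_map_def trunc_def)
qed (simp add: finite_lists_length_eq finite_E)

text \<open>
  The pigeonhole principle is applied to the vertices of the level \<open>j\<close> at which the cuts are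
  disjoint, so the number of points is compared with their number. The uniform bound on the squares
  is the number of conceivable prefixes of length \<open>j\<close>, and its factorial serves as the period.\<close>

lemma disjoint_cuts_imp_periodic:
  assumes Y: "Y \<subseteq> X" and card: "card (V j) < card Y" and ij: "i \<le> j"
    and comp: "pairwise (compatible B i) Y"
    and nocut: "pairwise (\<lambda>x x'. \<not> common_cut B j x x') Y"
  shows "periodic_subshift (factor_space B i)"
proof -
  have "Y \<noteq> {}" using card by auto
  then obtain y where y: "y \<in> Y" "y \<in> X" using Y by blast
  have same: "factor_map B i y' = factor_map B i y" if "y' \<in> Y" for y'
  proof (cases "y' = y")
    case False
    then have "compatible B i y' y" using comp y(1) that unfolding pairwise_def by blast
    then show ?thesis by (simp add: compatible_def)
  qed simp
  have "\<exists>q. \<forall>t<l. factor_map B i y (q + int t) =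
      factor_map B i y (q + int t + int (fact (prefix_bound j)))" for l
    by (rule bounded_squares_imp_long_periodic_subwords[OF finite_range_factor_map[OF y(2)]
          square_at_every_position[OF Y card ij nocut same]])
  then show ?thesis by (rule long_periodic_windows_imp_periodic_subshift[OF y(2) fact_gt_zero])
qed

end

theorem corollary4p1:
  fixes B :: "('v, 'e) ordered_bratteli" and K i :: nat
  assumes "properly_ordered B"
    and "has_rank B K"
    and "infinite (path_space B)"
    and "1 \<le> i"
    and "\<exists>Y \<subseteq> path_space B. card Y \<ge> (K - 1) * 2 ^ K + 2 \<and>
           pairwise (compatible B i) Y \<and>
           (\<exists>j>i. pairwise (\<lambda>x x'. \<not> common_cut B j x x') Y)"
  shows "periodic_subshift (factor_space B i)"
proof -
  interpret bratteli_vershik B by unfold_locales (rule assms(1))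
  obtain Y j where Y: "Y \<subseteq> path_space B" "card Y \<ge> (K - 1) * 2 ^ K + 2"
    "pairwise (compatible B i) Y" "i < j" "pairwise (\<lambda>x x'. \<not> common_cut B j x x') Y"
    using assms(5) by blast
  have K: "card (verts B j) = K" using assms(2,4) Y(4) by (simp add: has_rank_def)
  have "(K - 1) * 1 \<le> (K - 1) * 2 ^ K" by (intro mult_le_mono2) simp
  then have "card (verts B j) < card Y" using K Y(2) by linarith
  then show ?thesis using disjoint_cuts_imp_periodic Y by (meson less_imp_le)
qed

end
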